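(* Let $n$, $k$, $t$ and $s$ be positive integers with $k\geq t+2$ and $n\geq 3\max\left\{\binom{t+2}{2}, \frac{k-t}{2} \right\}\left((k-t+1)^{2}+s\right)$. Suppose $\mathcal{F}\subseteq \binom{[n]}{k}$ is an $s$-almost $t$-intersecting family which is not $t$-intersecting, and that $\mathcal{F}$ has the maximum size among all $s$-almost $t$-intersecting subfamilies of $\binom{[n]}{k}$ that are not $t$-intersecting. Then $$\mathcal{F}\cong\left\{F\in\binom{[n]}{k}: [t]\subseteq F,\ \left|F\cap [k+1]\right|\geq t+1\right\}\cup \mathcal{A}\cup \mathcal{B},$$ where $\mathcal{A}$ is an $s$-subset of $\left\{ F\in\binom{[n]}{k}: F\cap [k+1]=[t]\right\}$ and $\mathcal{B}$ is a $\min\{t,s\}$-subset of $\left\{F\in\binom{[k+1]}{k}: [t]\not\subseteq F\right\}$.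
   Context: $[n]=\{1,\dots,n\}$ and $\binom{X}{k}$ denotes the family of all $k$-subsets of a set $X$. A family $\mathcal{F}\subseteq\binom{[n]}{k}$ is called $s$-almost $t$-intersecting if $\left|\{F'\in\mathcal{F}: |F'\cap F|<t\}\right|\leq s$ for every $F\in\mathcal{F}$; it is $t$-intersecting if $|F\cap F'|\geq t$ for all $F,F'\in\mathcal{F}$. $\mathcal{F}\cong\mathcal{G}$ means there is a permutation of $[n]$ mapping $\mathcal{F}$ onto $\mathcal{G}$. An $m$-subset of a family is a subfamily with exactly $m$ members. *)

theory Defs
  imports Complex_Main "HOL-Library.Ramsey" "HOL-Combinatorics.Permutations"
begin

text \<open>
  The ground set is \<^term>\<open>{1..n}\<close>, and the family of all \<open>k\<close>-subsets of \<open>X\<close> is the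
  library's \<^term>\<open>nsets X k\<close>.
\<close>

definition t_intersecting :: "nat \<Rightarrow> nat set set \<Rightarrow> bool" where
  "t_intersecting t \<F> \<longleftrightarrow> (\<forall>F\<in>\<F>. \<forall>F'\<in>\<F>. card (F \<inter> F') \<ge> t)"

definition almost_t_intersecting :: "nat \<Rightarrow> nat \<Rightarrow> nat set set \<Rightarrow> bool" where
  "almost_t_intersecting s t \<F> \<longleftrightarrow> (\<forall>F\<in>\<F>. card {F'\<in>\<F>. card (F' \<inter> F) < t} \<le> s)"

definition family_iso :: "nat \<Rightarrow> nat set set \<Rightarrow> nat set set \<Rightarrow> bool" where
  "family_iso n \<F> \<G> \<longleftrightarrow> (\<exists>\<pi>. \<pi> permutes {1..n} \<and> (\<lambda>F. \<pi> ` F) ` \<F> = \<G>)"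

definition almost_not_t_intersecting :: "nat \<Rightarrow> nat \<Rightarrow> nat \<Rightarrow> nat \<Rightarrow> nat set set \<Rightarrow> bool" where
  "almost_not_t_intersecting n k s t \<F> \<longleftrightarrow>
     \<F> \<subseteq> nsets {1..n} k \<and> almost_t_intersecting s t \<F> \<and> \<not> t_intersecting t \<F>"

end

theory Submission
  imports Defs
begin

text \<open>
  If no set of size \<open>t + 1\<close> meets every member in \<open>t\<close> points (is a \<open>t\<close>-cover), branching from
  the \<open>t\<close>-subsets of a smallest cover shows that \<open>\<F>\<close> is too small. Otherwise let \<open>W\<close> be a cover of
  size \<open>t + 1\<close>. Two members meeting in fewer than \<open>t\<close> points have traces \<open>W - {x}\<close> and \<open>W - {y}\<close>
  with \<open>x \<noteq> y\<close>, and for one of them, say \<open>T = W - {y}\<close>, no single point outside \<open>W\<close> lies in all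
  members with this trace. Branching twice along such members, few members fail to contain \<open>T\<close>.
  If these exceptional members \<open>E\<close> do not all have the same \<open>E - T\<close>, then the members containing \<open>T\<close>
  lose a positive proportion against the extremal family. Otherwise all \<open>E\<close> lie in a set \<open>Z \<supseteq> T\<close> of
  size \<open>k + 1\<close>, and double use of the almost-intersection bound, for the \<open>E\<close> and for the members
  meeting \<open>Z\<close> exactly in \<open>T\<close>, gives the upper bound together with the equality case.
\<close>

section \<open>Branching in almost intersecting families\<close>

locale almost_intersecting =
  fixes n k t s :: nat and \<F> :: "nat set set"
  assumes subset_nsets: "\<F> \<subseteq> nsets {1..n} k"
    and almost: "almost_t_intersecting s t \<F>"
begin

lemma finite_family: "finite \<F>"
  using subset_nsets finite_imp_finite_nsets[of "{1..n}" k] finite_subset by blast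

lemma memD:
  assumes "A \<in> \<F>"
  shows "finite A" "card A = k" "A \<subseteq> {1..n}"
  using assms subset_nsets by (auto simp: nsets_def)

lemma card_disturbing_le:
  assumes "A \<in> \<F>"
  shows "card {B \<in> \<F>. card (B \<inter> A) < t} \<le> s"
  using almost assms by (auto simp: almost_t_intersecting_def)

end

section \<open>Counting the sets above a fixed set\<close>

lemma card_supersets_nsets:
  assumes "finite X" "U \<subseteq> X" "card U \<le> k"
  shows "card {A \<in> nsets X k. U \<subseteq> A} = (card X - card U) choose (k - card U)"
proof -
  have fU: "finite U" using assms finite_subset by blast
  have "bij_betw (\<lambda>A. A \<union> U) (nsets (X - U) (k - card U)) {A \<in> nsets X k. U \<subseteq> A}"
  proof (rule bij_betw_byWitness[where f' = "\<lambda>A. A - U"])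
    show "\<forall>A\<in>nsets (X - U) (k - card U). A \<union> U - U = A" by (auto simp: nsets_def)
    show "\<forall>A\<in>{A \<in> nsets X k. U \<subseteq> A}. A - U \<union> U = A" by auto
    show "(\<lambda>A. A \<union> U) ` nsets (X - U) (k - card U) \<subseteq> {A \<in> nsets X k. U \<subseteq> A}"
    proof (clarsimp simp: nsets_def)
      fix A assume "A \<subseteq> X - U" "finite A" "card A = k - card U"
      then have "card (A \<union> U) = card A + card U"
        using fU by (intro card_Un_disjoint) auto
      then show "A \<subseteq> X \<and> U \<subseteq> X \<and> finite U \<and> card (A \<union> U) = k"
        using assms fU \<open>A \<subseteq> X - U\<close> \<open>card A = k - card U\<close> by auto
    qed
    show "(\<lambda>A. A - U) ` {A \<in> nsets X k. U \<subseteq> A} \<subseteq> nsets (X - U) (k - card U)"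
      by (auto simp: nsets_def card_Diff_subset fU)
  qed
  then have "card {A \<in> nsets X k. U \<subseteq> A} = card (nsets (X - U) (k - card U))"
    by (metis bij_betw_same_card)
  then show ?thesis
    using assms fU
    by (simp add: card_Diff_subset)
qed

lemma card_UNION_le_mult:
  assumes "finite V" "\<S> \<subseteq> (\<Union>v\<in>V. B v)" "\<And>v. v \<in> V \<Longrightarrow> finite (B v)" "\<And>v. v \<in> V \<Longrightarrow> card (B v) \<le> c"
  shows "card \<S> \<le> card V * c"
proof -
  have "card \<S> \<le> card (\<Union>v\<in>V. B v)"
    using assms by (intro card_mono) auto
  also have "\<dots> \<le> (\<Sum>v\<in>V. card (B v))" by (rule card_UN_le[OF assms(1)])
  also have "\<dots> \<le> card V * c" using sum_bounded_above[of V "\<lambda>v. card (B v)" c] assms(4) by simp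
  finally show ?thesis .
qed

context almost_intersecting
begin

lemma card_star_le:
  assumes "finite U" "card U = u"
  shows "card {A \<in> \<F>. U \<subseteq> A} \<le> (n - u) choose (k - u)"
proof (cases "U \<subseteq> {1..n} \<and> u \<le> k")
  case True
  have "card {A \<in> \<F>. U \<subseteq> A} \<le> card {A \<in> nsets {1..n} k. U \<subseteq> A}"
    using subset_nsets finite_imp_finite_nsets[of "{1..n}" k] by (intro card_mono) auto
  then show ?thesis using card_supersets_nsets[of "{1..n}" U k] True assms by simp
next
  case False
  then have "{A \<in> \<F>. U \<subseteq> A} = {}"
    using memD assms card_mono by blast
  then show ?thesis by (simp only: card.empty le0)
qed

text \<open>The basic branching step: at most \<open>s\<close> members disturb \<open>A\<close>, and
  every other member of \<open>\<S>\<close> runs through a point of \<open>S\<close>.\<close>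

lemma card_le_sum_star:
  assumes "A \<in> \<F>" "\<S> \<subseteq> \<F>" "finite S"
    and meet: "\<And>B. B \<in> \<S> \<Longrightarrow> t \<le> card (B \<inter> A) \<Longrightarrow> B \<inter> S \<noteq> {}"
  shows "card \<S> \<le> s + (\<Sum>v\<in>S. card {B \<in> \<S>. v \<in> B})"
proof -
  have fS: "finite \<S>" using assms(2) finite_family finite_subset by blast
  have "\<S> \<subseteq> {B \<in> \<F>. card (B \<inter> A) < t} \<union> (\<Union>v\<in>S. {B \<in> \<S>. v \<in> B})"
  proof
    fix B assume "B \<in> \<S>"
    then show "B \<in> {B \<in> \<F>. card (B \<inter> A) < t} \<union> (\<Union>v\<in>S. {B \<in> \<S>. v \<in> B})"
      using assms(2) meet[of B] by (cases "t \<le> card (B \<inter> A)") auto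
  qed
  then have "card \<S> \<le> card ({B \<in> \<F>. card (B \<inter> A) < t} \<union> (\<Union>v\<in>S. {B \<in> \<S>. v \<in> B}))"
    using finite_family fS \<open>finite S\<close> by (intro card_mono) auto
  also have "\<dots> \<le> card {B \<in> \<F>. card (B \<inter> A) < t} + card (\<Union>v\<in>S. {B \<in> \<S>. v \<in> B})"
    by (rule card_Un_le)
  also have "\<dots> \<le> s + (\<Sum>v\<in>S. card {B \<in> \<S>. v \<in> B})"
    by (intro add_mono card_disturbing_le card_UN_le assms)
  finally show ?thesis .
qed

lemma card_le_mult_star:
  assumes "A \<in> \<F>" "\<S> \<subseteq> \<F>" "finite S"
    and "\<And>B. B \<in> \<S> \<Longrightarrow> t \<le> card (B \<inter> A) \<Longrightarrow> B \<inter> S \<noteq> {}"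
    and "\<And>v. v \<in> S \<Longrightarrow> card {B \<in> \<S>. v \<in> B} \<le> c"
  shows "card \<S> \<le> s + card S * c"
  using card_le_sum_star[OF assms(1-4)] sum_bounded_above[of S "\<lambda>v. card {B \<in> \<S>. v \<in> B}" c] assms(5)
  by fastforce

text \<open>Fewer than \<open>t\<close> points of \<open>A\<close> lie outside \<open>S\<close>, too
  few for all of \<open>B \<inter> A\<close>. This is where the branching factor
  \<open>k - t + 1\<close> comes from.\<close>

lemma meets_large_subset:
  assumes "A \<in> \<F>" "S \<subseteq> A" "k < card S + t" "t \<le> card (B \<inter> A)"
  shows "B \<inter> S \<noteq> {}"
proof
  assume "B \<inter> S = {}"
  then have "card (B \<inter> A) \<le> card (A - S)"
    using memD(1)[OF assms(1)] by (intro card_mono) auto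
  also have "\<dots> = k - card S"
    using memD[OF assms(1)] assms(2) by (simp add: card_Diff_subset finite_subset)
  finally show False using assms memD[OF assms(1)] card_mono[of A S] by linarith
qed

text \<open>A set \<open>U\<close> that is not a \<open>t\<close>-cover is enlarged by one of only \<open>k - t + 1\<close> elements, no matter
  how small its intersection with the witness is.\<close>

lemma card_star_branching:
  assumes covers: "\<And>U. finite U \<Longrightarrow> t \<le> card U \<Longrightarrow> card U < t + J \<Longrightarrow> \<exists>A\<in>\<F>. card (A \<inter> U) < t"
    and "t \<le> k" "finite U" "t \<le> card U" "card U + p = t + J"
  shows "card {A \<in> \<F>. U \<subseteq> A} \<le>
    s * (\<Sum>q<p. (k - t + 1) ^ q) + (k - t + 1) ^ p * ((n - (t + J)) choose (k - (t + J)))"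
  using assms(3-5)
proof (induction p arbitrary: U)
  case 0
  then show ?case using card_star_le[of U "t + J"] by simp
next
  case (Suc p)
  let ?m = "k - t + 1"
  obtain A where A: "A \<in> \<F>" "card (A \<inter> U) < t"
    using covers[of U] Suc.prems by auto
  have "card (A - U) = k - card (A \<inter> U)"
    using memD[OF A(1)] by (simp add: card_Diff_subset_Int)
  \<comment> \<open>The branching set is taken outside \<open>U\<close>, so each branch increases
    \<open>card U\<close> by one and leaves \<open>p\<close> further rounds.\<close>
  then have "?m \<le> card (A - U)" using A(2) \<open>t \<le> k\<close> by linarith
  then obtain S where S: "S \<subseteq> A - U" "card S = ?m"
    using memD(1)[OF A(1)] by (meson obtain_subset_with_card_n)
  have fS: "finite S" using S memD(1)[OF A(1)] finite_subset by blast
  have "card {A \<in> \<F>. U \<subseteq> A} \<le> s + card S *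
      (s * (\<Sum>q<p. ?m ^ q) + ?m ^ p * ((n - (t + J)) choose (k - (t + J))))"
  proof (rule card_le_mult_star[OF A(1) _ fS])
    fix B assume "t \<le> card (B \<inter> A)"
    then show "B \<inter> S \<noteq> {}"
      using meets_large_subset[OF A(1), of S B] S \<open>t \<le> k\<close> by auto
  next
    fix v assume v: "v \<in> S"
    have "{B \<in> {A \<in> \<F>. U \<subseteq> A}. v \<in> B} = {A \<in> \<F>. insert v U \<subseteq> A}" by auto
    moreover have "card (insert v U) = Suc (card U)" using v S Suc.prems by auto
    ultimately show "card {B \<in> {A \<in> \<F>. U \<subseteq> A}. v \<in> B} \<le>
      s * (\<Sum>q<p. ?m ^ q) + ?m ^ p * ((n - (t + J)) choose (k - (t + J)))"
      using Suc.IH[of "insert v U"] Suc.prems by simp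
  qed auto
  also have "\<dots> = s * (\<Sum>q<Suc p. ?m ^ q) + ?m ^ Suc p * ((n - (t + J)) choose (k - (t + J)))"
    using S(2) by (simp add: sum.lessThan_Suc_shift sum_distrib_left algebra_simps del: sum.lessThan_Suc)
  finally show ?case .
qed

text \<open>The first branching runs over the \<open>t\<close>-subsets of a set \<open>C\<close> of
  size \<open>t + J\<close>, each with \<open>J\<close> rounds left. Either \<open>C\<close> is a
  cover, or \<open>t + J = k\<close> and any member serves as \<open>C\<close>; the at most
  \<open>s\<close> members disturbing it give the leading summand.\<close>

lemma card_le_no_small_cover:
  assumes "t \<le> k" "\<F> \<noteq> {}"
    and nocover: "\<And>U. finite U \<Longrightarrow> t \<le> card U \<Longrightarrow> card U < t + J \<Longrightarrow> \<exists>A\<in>\<F>. card (A \<inter> U) < t"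
    and stop: "t + J = k \<or> (\<exists>C. finite C \<and> card C = t + J \<and> (\<forall>A\<in>\<F>. t \<le> card (A \<inter> C)))"
  shows "card \<F> \<le> s + ((t + J) choose t) *
    (s * (\<Sum>q<J. (k - t + 1) ^ q) + (k - t + 1) ^ J * ((n - (t + J)) choose (k - (t + J))))"
proof -
  let ?b = "s * (\<Sum>q<J. (k - t + 1) ^ q) + (k - t + 1) ^ J * ((n - (t + J)) choose (k - (t + J)))"
  have "\<exists>C. finite C \<and> card C = t + J \<and> card {A \<in> \<F>. card (A \<inter> C) < t} \<le> s"
    using stop
  proof
    assume "t + J = k"
    moreover obtain A where "A \<in> \<F>" using assms(2) by auto
    ultimately show ?thesis using memD[of A] card_disturbing_le[of A] by auto
  next
    assume "\<exists>C. finite C \<and> card C = t + J \<and> (\<forall>A\<in>\<F>. t \<le> card (A \<inter> C))"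
    then obtain C where C: "finite C" "card C = t + J" "\<forall>A\<in>\<F>. t \<le> card (A \<inter> C)" by auto
    then have "{A \<in> \<F>. card (A \<inter> C) < t} = {}" by (auto simp: not_less)
    then show ?thesis using C by (metis card.empty le0)
  qed
  then obtain C where C: "finite C" "card C = t + J" "card {A \<in> \<F>. card (A \<inter> C) < t} \<le> s" by blast
  have "{A \<in> \<F>. t \<le> card (A \<inter> C)} \<subseteq> (\<Union>T\<in>nsets C t. {A \<in> \<F>. T \<subseteq> A})"
  proof
    fix A assume A: "A \<in> {A \<in> \<F>. t \<le> card (A \<inter> C)}"
    then show "A \<in> (\<Union>T\<in>nsets C t. {A \<in> \<F>. T \<subseteq> A})"
    proof -
      have "t \<le> card (A \<inter> C)" using A by simp
      then obtain T where T: "T \<subseteq> A \<inter> C" "card T = t" "finite T"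
        by (rule obtain_subset_with_card_n)
      then have "T \<in> nsets C t" "T \<subseteq> A"
        by (simp_all add: nsets_def)
      then show ?thesis using A by blast
    qed
  qed
  then have "card {A \<in> \<F>. t \<le> card (A \<inter> C)} \<le> card (nsets C t) * ?b"
  proof (rule card_UNION_le_mult[rotated])
    fix T assume "T \<in> nsets C t"
    then have "finite T" "card T = t" by (auto simp: nsets_def)
    then show "card {A \<in> \<F>. T \<subseteq> A} \<le> ?b"
      using card_star_branching[of J T J, OF nocover \<open>t \<le> k\<close>] by blast
  next
    show "finite (nsets C t)" using C finite_imp_finite_nsets by blast
  qed (use finite_family in simp)
  moreover have "card \<F> \<le> card {A \<in> \<F>. card (A \<inter> C) < t} + card {A \<in> \<F>. t \<le> card (A \<inter> C)}"
  proof -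
    have "card \<F> = card ({A \<in> \<F>. card (A \<inter> C) < t} \<union> {A \<in> \<F>. t \<le> card (A \<inter> C)})"
      by (rule arg_cong[where f = card]) auto
    also have "\<dots> \<le> card {A \<in> \<F>. card (A \<inter> C) < t} + card {A \<in> \<F>. t \<le> card (A \<inter> C)}"
      by (rule card_Un_le)
    finally show ?thesis .
  qed
  ultimately have "card \<F> \<le> s + card (nsets C t) * ?b" using C(3) by linarith
  moreover have "card (nsets C t) = (t + J) choose t" using C by simp
  ultimately show ?thesis by (simp only:)
qed

end

section \<open>Estimates for large ground sets\<close>

lemma le_binomial:
  fixes a b :: nat
  assumes "0 < b" "b < a"
  shows "a \<le> a choose b"
  using assms
proof (induction a arbitrary: b)
  case (Suc a)
  then obtain c where b: "b = Suc c" by (cases b) auto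
  show ?case
  proof (cases "c = 0")
    case False
    then have "a \<le> a choose c" using Suc b by auto
    moreover have "1 \<le> a choose Suc c" using Suc.prems b by (simp add: Suc_le_eq)
    ultimately show ?thesis using b by simp
  qed (simp add: b)
qed simp

locale parameters =
  fixes n k t s :: nat
  assumes t_pos: "t > 0" and s_pos: "s > 0" and k_ge: "k \<ge> t + 2"
    and n_ge: "real n \<ge> 3 * max (real ((t + 2) choose 2)) ((real k - real t) / 2)
                    * ((real k - real t + 1)^2 + real s)"
begin

text \<open>At most \<open>N j\<close> members of a \<open>k\<close>-uniform family contain a given set of size \<open>t + j\<close>.\<close>

definition m :: real where "m = real (k - t + 1)"
definition M :: real where "M = max (real ((t + 2) choose 2)) ((real k - real t) / 2)"
definition N :: "nat \<Rightarrow> real" where "N j = real ((n - (t + j)) choose (k - (t + j)))"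

section \<open>Lower bounds for \<open>m\<close>, \<open>M\<close> and \<open>n\<close>\<close>

lemma m_alt: "m = real k - real t + 1"
  using k_ge by (simp add: m_def of_nat_diff)

lemma m_diff: "m - 1 = real (k - t)"
  using k_ge by (simp add: m_alt of_nat_diff)

lemma m_ge: "m \<ge> 3"
  using k_ge by (simp add: m_alt)

lemma real_choose_t: "real ((t + 2) choose 2) = (real t + 2) * (real t + 1) / 2"
proof -
  have "2 * ((t + 2) choose 2) = (t + 2) * (t + 1)"
    using times_binomial_minus1_eq[of 2 "t + 2"] by simp
  then have "real (2 * ((t + 2) choose 2)) = real ((t + 2) * (t + 1))" by (rule arg_cong)
  then show ?thesis by (simp add: algebra_simps)
qed

lemma M_ge_choose: "(real t + 2) * (real t + 1) / 2 \<le> M"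
  by (simp add: M_def flip: real_choose_t)

lemma M_ge_half: "m - 1 \<le> 2 * M"
proof -
  have "(real k - real t) / 2 \<le> M" unfolding M_def by (rule max.cobounded2)
  then show ?thesis by (simp add: m_alt)
qed

lemma t_le_M: "3 * real t \<le> M"
proof (cases "t = 1")
  case True
  then show ?thesis using M_ge_choose by simp
next
  case False
  then have "real t \<ge> 2" using t_pos by simp
  then have "0 \<le> (real t - 1) * (real t - 2)" by (intro mult_nonneg_nonneg) auto
  then show ?thesis using M_ge_choose by (simp add: algebra_simps)
qed

lemma M_ge_3: "3 \<le> M"
  using t_le_M t_pos by simp

lemma n_ge': "3 * M * (m\<^sup>2 + real s) \<le> real n"
  using n_ge by (simp add: M_def m_alt)

lemma m_sq_ge: "9 \<le> m\<^sup>2"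
  using power_mono[OF m_ge, of 2] by simp

text \<open>A tenth of \<open>M * (m\<^sup>2 + real s)\<close> absorbs \<open>t + 1\<close>, at the
  price of lowering the constant 3 to 29/10. The reciprocal returns as the factor 10/29 in
  \<open>error_bound\<close>.\<close>

lemma n_minus_ge: "29/10 * M * (m\<^sup>2 + real s) \<le> real n - real t - 1"
proof -
  have "15 * (real t + 1) \<le> 10 * M"
    using M_ge_choose t_pos mult_right_mono[of 3 "real t + 2" "real t + 1"] by simp
  also have "10 * M \<le> (m\<^sup>2 + real s) * M"
    using m_sq_ge s_pos M_ge_3 by (intro mult_right_mono) auto
  finally have "real t + 1 \<le> 1/10 * (M * (m\<^sup>2 + real s))"
    using t_pos by (simp add: mult.commute)
  then show ?thesis using n_ge' by (simp only: mult.assoc)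
qed

lemma n_minus_k_ge: "2 * M * (m\<^sup>2 + real s) \<le> real n - real k"
proof -
  have "m - 1 \<le> 3 * M" using M_ge_half M_ge_3 by linarith
  also have "\<dots> \<le> M * (m\<^sup>2 + real s) * (3/10)"
    using m_sq_ge s_pos M_ge_3 mult_left_mono[of 10 "m\<^sup>2 + real s" M] by simp
  finally have "m - 1 \<le> M * (m\<^sup>2 + real s) * (3/10)" .
  moreover have "0 \<le> M * (m\<^sup>2 + real s)" using M_ge_3 by simp
  moreover have "real n - real k = (real n - real t - 1) - (m - 1) + 1" by (simp add: m_alt)
  ultimately show ?thesis using n_minus_ge by (simp only: mult.assoc)
qed

lemma n_gt_k_s: "k + s + 1 \<le> n"
proof -
  have "1 * (9 + real s) \<le> 2 * M * (m\<^sup>2 + real s)"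
    using m_sq_ge M_ge_3 by (intro mult_mono) auto
  then have "real (k + s + 1) \<le> real n" using n_minus_k_ge by simp
  then show ?thesis by linarith
qed

section \<open>Size and decay of \<open>N\<close>\<close>

lemma N_ge: "t + j < k \<Longrightarrow> real n - real (t + j) \<le> N j"
  using le_binomial[of "k - (t + j)" "n - (t + j)"] n_gt_k_s
  by (simp add: N_def of_nat_diff flip: of_nat_le_iff[where 'a = real])

lemma N_Suc: "t + j < k \<Longrightarrow> (real n - real (t + j)) * N (Suc j) = (real k - real (t + j)) * N j"
proof -
  assume j: "t + j < k"
  have "(k - (t + j)) * ((n - (t + j)) choose (k - (t + j)))
    = (n - (t + j)) * ((n - (t + j) - 1) choose (k - (t + j) - 1))"
    using times_binomial_minus1_eq[of "k - (t + j)" "n - (t + j)"] j by simp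
  then have "real (k - (t + j)) * N j = real (n - (t + j)) * N (Suc j)"
    unfolding N_def of_nat_mult[symmetric] of_nat_eq_iff by simp
  then show ?thesis using j n_gt_k_s by (simp add: of_nat_diff)
qed

lemma N_nonneg: "0 \<le> N j"
  by (simp add: N_def)

lemma N1_ge: "29/10 * M * (m\<^sup>2 + real s) \<le> N 1"
  using n_minus_ge N_ge[of 1] k_ge by simp

lemma N2_le: "29/10 * M * (m\<^sup>2 + real s) * N 2 \<le> (m - 2) * N 1"
proof -
  have "29/10 * M * (m\<^sup>2 + real s) * N 2 \<le> (real n - real t - 1) * N 2"
    using n_minus_ge N_nonneg by (intro mult_right_mono) auto
  also have "\<dots> = (m - 2) * N 1"
    using N_Suc[of 1] k_ge by (simp add: m_alt numeral_2_eq_2 diff_diff_eq add.commute)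
  finally show ?thesis .
qed

text \<open>The error terms of all estimates are combinations of \<open>s\<close> and \<open>N 2\<close>; the lower bound on \<open>n\<close>
  enters through this trade-off only.\<close>

definition X :: real where "X = M * real s"
definition Y :: real where "Y = M * m\<^sup>2 * N 2"

text \<open>The bounds \<open>N1_ge\<close> and \<open>N2_le\<close> share the factor
  \<open>m\<^sup>2 + real s\<close>. After multiplication by it, the \<open>X\<close> term uses the
  share \<open>s\<close> and the \<open>Y\<close> term the share \<open>m\<^sup>2\<close> of the
  right-hand side, so both can be charged to the same \<open>c\<close>.\<close>

lemma error_bound:
  assumes "0 \<le> \<alpha>" "0 \<le> \<beta>" "\<alpha> \<le> c" "\<beta> * (m - 2) \<le> c"
  shows "\<alpha> * X + \<beta> * Y \<le> 10/29 * c * N 1"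
proof -
  let ?z = "m\<^sup>2 + real s"
  have z: "0 < ?z" using m_sq_ge by (simp add: add_pos_nonneg)
  have "29/10 * M * ?z * (\<alpha> * real s) \<le> N 1 * (\<alpha> * real s)"
    using N1_ge assms(1) by (intro mult_right_mono) auto
  also have "\<dots> = \<alpha> * (N 1 * real s)" by simp
  also have "\<dots> \<le> c * (N 1 * real s)"
    using assms(3) N_nonneg by (intro mult_right_mono) auto
  finally have 1: "29/10 * M * ?z * (\<alpha> * real s) \<le> c * (N 1 * real s)" .
  have "29/10 * M * ?z * N 2 * (\<beta> * m\<^sup>2) \<le> (m - 2) * N 1 * (\<beta> * m\<^sup>2)"
    using N2_le assms(2) by (intro mult_right_mono) auto
  also have "\<dots> = (\<beta> * (m - 2)) * (N 1 * m\<^sup>2)" by simp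
  also have "\<dots> \<le> c * (N 1 * m\<^sup>2)"
    using assms(4) N_nonneg by (intro mult_right_mono) auto
  finally have 2: "29/10 * M * ?z * N 2 * (\<beta> * m\<^sup>2) \<le> c * (N 1 * m\<^sup>2)" .
  have "29/10 * (\<alpha> * X + \<beta> * Y) * ?z \<le> c * N 1 * ?z"
    using add_mono[OF 1 2] by (simp add: X_def Y_def algebra_simps)
  then have "29/10 * (\<alpha> * X + \<beta> * Y) \<le> c * N 1"
    using z mult_le_cancel_right_pos by blast
  then show ?thesis by simp
qed

lemma N1_pos: "0 < N 1"
proof -
  have "0 < 29/10 * M * (m\<^sup>2 + real s)" using m_sq_ge M_ge_3 by (intro mult_pos_pos) auto
  then show ?thesis using N1_ge by linarith
qed

text \<open>The Bonferroni lower bound for the number of \<open>k\<close>-sets that contain \<open>{1..t}\<close> and meet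
  \<open>{t+1..k+1}\<close>.\<close>

definition lower :: real where "lower = m * N 1 - m * (m - 1) / 2 * N 2"

text \<open>The entry \<open>(k - t) / 2\<close> of the maximum in \<open>M\<close> pays for one
  factor of the number of pairs.\<close>

lemma pairs_le: "m * (m - 1) / 2 * N 2 \<le> 1/m * Y"
proof -
  have "m * (m - 1) / 2 \<le> m * M" using M_ge_half m_ge by (simp add: mult_left_mono)
  also have "m * M = 1/m * (M * m\<^sup>2)" using m_ge by (simp add: power2_eq_square)
  finally have "m * (m - 1) / 2 * N 2 \<le> 1/m * (M * m\<^sup>2) * N 2"
    using N_nonneg by (rule mult_right_mono)
  then show ?thesis by (simp add: Y_def mult.assoc)
qed

lemma s_le: "0 \<le> a \<Longrightarrow> a * real s \<le> a/3 * X"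
  using mult_right_mono[OF M_ge_3, of "a * real s"] by (simp add: X_def algebra_simps)

lemma N2_le_Y: "0 \<le> a \<Longrightarrow> a * N 2 \<le> a / (3 * m\<^sup>2) * Y"
  using mult_right_mono[OF M_ge_3, of "a * N 2"] m_ge N_nonneg[of 2] by (simp add: Y_def algebra_simps)

lemma t_N2_le_Y: "0 \<le> a \<Longrightarrow> real t * a * N 2 \<le> a / (3 * m\<^sup>2) * Y"
  using mult_right_mono[OF t_le_M, of "a * N 2"] m_ge N_nonneg[of 2] by (simp add: Y_def algebra_simps)

text \<open>In \<open>card_star_le_common\<close> a point common to all exceptional members costs
  \<open>N 1\<close>, any other point \<open>s + m * N 2\<close>. That the latter is no dearer makes
  the bound there monotone in the number of common points.\<close>

lemma s_m_N2_le: "real s + m * N 2 \<le> N 1"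
proof -
  have "1 * real s + m * N 2 \<le> 1/3 * X + m / (3 * m\<^sup>2) * Y"
    using m_ge by (intro add_mono s_le N2_le_Y) auto
  also have "\<dots> \<le> 10/29 * 1 * N 1"
    using m_ge by (intro error_bound) (auto simp: field_simps power2_eq_square)
  finally show ?thesis using N1_pos by simp
qed

text \<open>Up to a summand \<open>s\<close> this is the branching bound for \<open>J = 2\<close>,
  the worst case by \<open>cover_bound_antimono\<close>. Its binomial coefficient is an entry of the
  maximum in \<open>M\<close>.\<close>

lemma two_cover_bound:
  "real ((t + 2) choose 2) * (real s * (1 + m) + m\<^sup>2 * N 2) < lower"
proof -
  have "real ((t + 2) choose 2) * (real s * (1 + m) + m\<^sup>2 * N 2) \<le> M * (real s * (1 + m) + m\<^sup>2 * N 2)"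
    using N_nonneg[of 2] m_ge by (intro mult_right_mono) (auto simp: M_def)
  also have "\<dots> = (1 + m) * X + Y" by (simp add: X_def Y_def algebra_simps)
  finally have "real ((t + 2) choose 2) * (real s * (1 + m) + m\<^sup>2 * N 2) + m * (m - 1) / 2 * N 2
    \<le> (1 + m) * X + (1 + 1/m) * Y"
    using pairs_le by (simp only: distrib_right[of 1 "1/m"])
  also have "\<dots> \<le> 10/29 * (m + 1) * N 1"
    using m_ge by (intro error_bound) (auto simp: field_simps)
  also have "\<dots> < m * N 1" using N1_pos m_ge by (intro mult_strict_right_mono) auto
  finally show ?thesis by (simp add: lower_def)
qed

text \<open>Used against the case that the members of each of two traces have a common point outside
  \<open>W\<close>. One \<open>N 1\<close> stands on the left against \<open>m\<close> of them in
  \<open>lower\<close>, so the errors may use nearly \<open>(m - 1) * N 1\<close>.\<close>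

lemma both_covered_bound:
  "N 1 + 2 * real s + 2 * (m - 1) * N 2 + (real t - 1) * (m - 1)\<^sup>2 * N 2 < lower + real s"
proof -
  \<comment> \<open>As \<open>m \<ge> 3\<close>, the term \<open>2 * (m - 1)\<close> is at most the
    one copy of \<open>(m - 1)\<^sup>2\<close> that separates \<open>t - 1\<close> from
    \<open>t\<close>.\<close>
  have "2 * (m - 1) \<le> (m - 1) * (m - 1)" using m_ge by (intro mult_right_mono) auto
  then have "(2 * (m - 1) + (real t - 1) * (m - 1)\<^sup>2) * N 2 \<le> (real t * (m - 1)\<^sup>2) * N 2"
    using N_nonneg by (intro mult_right_mono) (auto simp: algebra_simps power2_eq_square)
  also have "\<dots> \<le> (m - 1)\<^sup>2 / (3 * m\<^sup>2) * Y"
    by (rule t_N2_le_Y) simp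
  finally have "1 * real s + ((2 * (m - 1) + (real t - 1) * (m - 1)\<^sup>2) * N 2 + m * (m - 1) / 2 * N 2)
    \<le> 1/3 * X + ((m - 1)\<^sup>2 / (3 * m\<^sup>2) * Y + 1/m * Y)"
    by (intro add_mono s_le pairs_le) auto
  also have "\<dots> = 1/3 * X + ((m - 1)\<^sup>2 / (3 * m\<^sup>2) + 1/m) * Y" by (simp only: distrib_right)
  also have "\<dots> \<le> 10/29 * (m - 2) * N 1"
  proof (intro error_bound)
    have "(m - 1)\<^sup>2 / (3 * m\<^sup>2) \<le> 1/3" "1/m \<le> 1/3" using m_ge by (auto simp: field_simps power2_eq_square)
    then have "(m - 1)\<^sup>2 / (3 * m\<^sup>2) + 1/m \<le> 1" by linarith
    then show "((m - 1)\<^sup>2 / (3 * m\<^sup>2) + 1/m) * (m - 2) \<le> m - 2"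
      using m_ge by (intro mult_left_le_one_le) auto
  qed (use m_ge in auto)
  also have "\<dots> < (m - 1) * N 1" using N1_pos m_ge by (intro mult_strict_right_mono) auto
  finally show ?thesis by (simp add: lower_def algebra_simps)
qed

text \<open>With at most two points common to the exceptional members, the spare
  \<open>(m - 2) * N 1\<close> covers even the crude bound of
  \<open>card_not_containing_le\<close>.\<close>

lemma small_intersection_bound:
  "real s + 2 * N 1 + (m - 2) * (real s + m * N 2) + (real s + (m - 1) * real s + real t * (m - 1)\<^sup>2 * N 2)
    < lower + real s"
proof -
  have "(2 * m - 2) * real s + ((m - 2) * m * N 2 + real t * (m - 1)\<^sup>2 * N 2 + m * (m - 1) / 2 * N 2)
    \<le> (2 * m - 2)/3 * X
      + (((m - 2) * m) / (3 * m\<^sup>2) * Y + (m - 1)\<^sup>2 / (3 * m\<^sup>2) * Y + 1/m * Y)"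
    using m_ge by (intro add_mono s_le N2_le_Y t_N2_le_Y pairs_le) auto
  also have "\<dots> = (2 * m - 2)/3 * X
      + (((m - 2) * m) / (3 * m\<^sup>2) + (m - 1)\<^sup>2 / (3 * m\<^sup>2) + 1/m) * Y"
    by (simp only: distrib_right)
  also have "\<dots> \<le> 10/29 * ((2 * m - 2)/3) * N 1"
  proof (intro error_bound)
    have "((m - 2) * m) / (3 * m\<^sup>2) + (m - 1)\<^sup>2 / (3 * m\<^sup>2) + 1/m \<le> (m - 2) / (3 * m) + 1/3 + 1/m"
      using m_ge by (intro add_mono) (auto simp: field_simps power2_eq_square)
    also have "\<dots> = (2 * m + 1) / (3 * m)" using m_ge by (simp add: field_simps)
    finally have "(((m - 2) * m) / (3 * m\<^sup>2) + (m - 1)\<^sup>2 / (3 * m\<^sup>2) + 1/m) * (m - 2)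
      \<le> (2 * m + 1) / (3 * m) * (m - 2)"
      using m_ge by (intro mult_right_mono) auto
    also have "\<dots> \<le> (2 * m - 2)/3" using m_ge by (simp add: field_simps)
    finally show "(((m - 2) * m) / (3 * m\<^sup>2) + (m - 1)\<^sup>2 / (3 * m\<^sup>2) + 1/m) * (m - 2) \<le> (2 * m - 2)/3" .
  qed (use m_ge in auto)
  also have "\<dots> < (m - 2) * N 1" using N1_pos m_ge by (intro mult_strict_right_mono) auto
  finally show ?thesis by (simp add: lower_def algebra_simps)
qed

text \<open>With up to \<open>k - t\<close> common points only a single \<open>N 1\<close> is spare,
  so the exceptional members enter with the sharper bound \<open>t * N 2\<close>.\<close>

lemma large_intersection_bound:
  "real s + (m - 1) * N 1 + (real s + m * N 2) + real t * N 2 < lower + real s"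
proof -
  have "1 * real s + (m * N 2 + real t * 1 * N 2 + m * (m - 1) / 2 * N 2)
    \<le> 1/3 * X + (m / (3 * m\<^sup>2) * Y + 1 / (3 * m\<^sup>2) * Y + 1/m * Y)"
    using m_ge by (intro add_mono s_le N2_le_Y t_N2_le_Y pairs_le) auto
  also have "\<dots> = 1/3 * X + (m / (3 * m\<^sup>2) + 1 / (3 * m\<^sup>2) + 1/m) * Y"
    by (simp only: distrib_right)
  also have "\<dots> \<le> 10/29 * 2 * N 1"
    using m_ge by (intro error_bound) (auto simp: field_simps power2_eq_square)
  also have "\<dots> < N 1" using N1_pos by simp
  finally show ?thesis by (simp add: lower_def algebra_simps)
qed

text \<open>Longer branching is cheaper. From \<open>J\<close> to \<open>J + 1\<close> the binomial
  coefficient grows by the factor \<open>r\<close> and the number of branches by \<open>m\<close>,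
  while \<open>N (Suc J)\<close> is \<open>N J\<close> times
  \<open>(k - t - J) / (n - t - J)\<close>.\<close>

lemma cover_bound_antimono:
  assumes "2 \<le> J" "t + J \<le> k"
  shows "real ((t + J) choose t) * (real s * (\<Sum>q<J. m ^ q) + m ^ J * N J)
    \<le> real ((t + 2) choose 2) * (real s * (1 + m) + m\<^sup>2 * N 2)"
  using assms
proof (induction J rule: dec_induct)
  case base
  have "(t + 2) choose t = (t + 2) choose 2"
    using binomial_symmetric[of t "t + 2"] by simp
  then show ?case by (simp add: numeral_2_eq_2)
next
  case (step J)
  define r where "r = (real t + real J + 1) / (real J + 1)"
  define \<sigma> where "\<sigma> = (\<Sum>q<J. m ^ q)"
  have "(Suc J) * ((t + Suc J) choose Suc J) = (t + Suc J) * ((t + J) choose J)"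
    using times_binomial_minus1_eq[of "Suc J" "t + Suc J"] by simp
  then have "(real J + 1) * real ((t + Suc J) choose t) = (real t + real J + 1) * real ((t + J) choose t)"
    using binomial_symmetric[of t "t + J"] binomial_symmetric[of t "t + Suc J"]
    by (simp flip: of_nat_mult of_nat_Suc of_nat_add add: add.commute)
  then have choose: "real ((t + Suc J) choose t) = r * real ((t + J) choose t)"
    by (simp add: r_def field_simps)
  \<comment> \<open>The ratio \<open>r\<close> equals \<open>1 + t / (J + 1)\<close> and is largest
    at \<open>J = 2\<close>.\<close>
  have r: "0 \<le> r" "3 * r \<le> real t + 3"
  proof -
    show "0 \<le> r" by (simp add: r_def)
    have "0 \<le> (real J - 2) * real t" using step.hyps by (intro mult_nonneg_nonneg) auto
    then show "3 * r \<le> real t + 3" using step.hyps by (simp add: r_def field_simps)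
  qed
  \<comment> \<open>With ratio at least 3 the geometric sum is at most half of the next power; hence
    the constant 3/2 below.\<close>
  have \<sigma>: "2 * \<sigma> \<le> m ^ J"
  proof -
    have "(m - 1) * \<sigma> = m ^ J - 1" using power_diff_1_eq[of m J] by (simp add: \<sigma>_def)
    moreover have "0 \<le> \<sigma>" using m_ge by (simp add: \<sigma>_def sum_nonneg)
    then have "2 * \<sigma> \<le> (m - 1) * \<sigma>" using m_ge by (intro mult_right_mono) auto
    ultimately show ?thesis by linarith
  qed
  define a where "a = real n - real (t + J)"
  have a: "0 < a" "r * (3/2) * (real s + m\<^sup>2) \<le> a"
  proof -
    show "0 < a" using n_gt_k_s step.prems by (simp add: a_def)
    have "real t + 3 \<le> 2 * M" using t_le_M M_ge_3 by linarith
    then have "r * (3/2) \<le> M" using r by linarith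
    then have "r * (3/2) * (real s + m\<^sup>2) \<le> M * (real s + m\<^sup>2)" by (intro mult_right_mono) auto
    also have "\<dots> \<le> 2 * M * (m\<^sup>2 + real s)" using M_ge_3 by (simp add: algebra_simps)
    also have "\<dots> \<le> a" using n_minus_k_ge step.prems by (simp add: a_def)
    finally show "r * (3/2) * (real s + m\<^sup>2) \<le> a" .
  qed
  \<comment> \<open>After multiplication by \<open>a\<close>, \<open>N_Suc\<close> turns
    \<open>N (Suc J)\<close> into a multiple of \<open>N J\<close>, and \<open>a \<le> N J\<close>
    does the same for the \<open>s\<close> term.\<close>
  have "a * (r * (3/2) * real s + r * m * N (Suc J))
    = r * (3/2) * real s * a + r * m * (a * N (Suc J))" by (simp add: algebra_simps)
  also have "a * N (Suc J) = (real k - real (t + J)) * N J"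
    using N_Suc[of J] step.prems by (simp add: a_def)
  also have "r * (3/2) * real s * a + r * m * ((real k - real (t + J)) * N J)
    \<le> r * (3/2) * real s * N J + r * m * (m * N J)"
    using N_ge[of J] step.prems r(1) m_ge N_nonneg[of J]
    by (intro add_mono mult_left_mono mult_right_mono) (auto simp: a_def m_alt)
  also have "\<dots> \<le> r * (3/2) * (real s + m\<^sup>2) * N J"
    using r(1) N_nonneg[of J] m_ge by (simp add: algebra_simps power2_eq_square)
  also have "\<dots> \<le> a * N J" using a(2) N_nonneg by (intro mult_right_mono) auto
  finally have key: "r * (3/2) * real s + r * m * N (Suc J) \<le> N J"
    using a(1) by simp
  have "r * (real s * (\<Sum>q<Suc J. m ^ q) + m ^ Suc J * N (Suc J))
    = r * real s * (\<sigma> + m ^ J) + m ^ J * (r * m * N (Suc J))"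
    by (simp add: \<sigma>_def algebra_simps)
  also have "\<dots> \<le> r * real s * (3/2 * m ^ J) + m ^ J * (r * m * N (Suc J))"
    using \<sigma> r(1) by (intro add_right_mono mult_left_mono) auto
  also have "\<dots> = m ^ J * (r * (3/2) * real s + r * m * N (Suc J))" by (simp add: algebra_simps)
  also have "\<dots> \<le> m ^ J * N J" using key m_ge by (intro mult_left_mono) auto
  also have "\<dots> \<le> real s * \<sigma> + m ^ J * N J" using m_ge by (simp add: \<sigma>_def sum_nonneg)
  finally have "r * (real s * (\<Sum>q<Suc J. m ^ q) + m ^ Suc J * N (Suc J))
    \<le> real s * (\<Sum>q<J. m ^ q) + m ^ J * N J" by (simp only: \<sigma>_def)
  then have "real ((t + J) choose t) * (r * (real s * (\<Sum>q<Suc J. m ^ q) + m ^ Suc J * N (Suc J)))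
    \<le> real ((t + J) choose t) * (real s * (\<Sum>q<J. m ^ q) + m ^ J * N J)"
    by (intro mult_left_mono) auto
  then show ?case using step.IH step.prems unfolding choose by (simp only: ac_simps) linarith
qed

end

section \<open>The structure of large families\<close>

locale almost_parameters = parameters n k t s + almost_intersecting n k t s \<F>
  for n k t s and \<F> :: "nat set set" +
  assumes not_intersecting: "\<not> t_intersecting t \<F>"
begin

text \<open>The least \<open>J \<ge> 2\<close> with \<open>t + J = k\<close> or a cover of size
  \<open>t + J\<close> leaves no cover of size from \<open>t\<close> to \<open>t + J - 1\<close>. So
  branching runs for \<open>J\<close> rounds, and \<open>cover_bound_antimono\<close> reduces the
  estimate to \<open>J = 2\<close>.\<close>

lemma no_small_cover_bound:
  assumes nocover: "\<And>W. finite W \<Longrightarrow> card W = t + 1 \<Longrightarrow> \<exists>A\<in>\<F>. card (A \<inter> W) < t"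
  shows "real (card \<F>) < lower + real s"
proof -
  define P where "P J \<longleftrightarrow> 2 \<le> J \<and>
    (t + J = k \<or> (\<exists>C. finite C \<and> card C = t + J \<and> (\<forall>A\<in>\<F>. t \<le> card (A \<inter> C))))" for J
  define J where "J = (LEAST J. P J)"
  have "P (k - t)" using k_ge by (simp add: P_def)
  then have J: "P J" "J \<le> k - t" unfolding J_def by (rule LeastI, rule Least_le)
  have nocover': "\<exists>A\<in>\<F>. card (A \<inter> U) < t" if U: "finite U" "t \<le> card U" "card U < t + J" for U
  proof -
    consider "card U = t" | "card U = t + 1" | "t + 2 \<le> card U" using U(2) by linarith
    then show ?thesis
    proof cases
      case 1
      \<comment> \<open>A cover of size \<open>t\<close> would become one of size
        \<open>t + 1\<close> by adding any point.\<close>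
      obtain z where "z \<notin> U" using \<open>finite U\<close> ex_new_if_finite infinite_UNIV_nat by blast
      then obtain A where A: "A \<in> \<F>" "card (A \<inter> insert z U) < t"
        using nocover[of "insert z U"] U 1 by auto
      have "card (A \<inter> U) \<le> card (A \<inter> insert z U)"
        using U(1) by (intro card_mono) auto
      then show ?thesis using A by (intro bexI[of _ A]) auto
    next
      case 2
      then show ?thesis using nocover U by blast
    next
      case 3
      then obtain j where j: "card U = t + j" "2 \<le> j" "j < J"
        using U(3) by (metis add_le_cancel_left le_iff_add nat_add_left_cancel_less order_trans)
      then have "\<not> P j" using not_less_Least unfolding J_def by blast
      then show ?thesis using j U(1) by (force simp: P_def not_le)
    qed
  qed
  have "\<F> \<noteq> {}" using not_intersecting by (auto simp: t_intersecting_def)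
  then have "card \<F> \<le> s + ((t + J) choose t) *
    (s * (\<Sum>q<J. (k - t + 1) ^ q) + (k - t + 1) ^ J * ((n - (t + J)) choose (k - (t + J))))"
    using k_ge J(1) nocover' unfolding P_def by (intro card_le_no_small_cover) auto
  then have "real (card \<F>) \<le> real (s + ((t + J) choose t) *
    (s * (\<Sum>q<J. (k - t + 1) ^ q) + (k - t + 1) ^ J * ((n - (t + J)) choose (k - (t + J)))))"
    by (simp only: of_nat_le_iff)
  also have "\<dots> = real s + real ((t + J) choose t) * (real s * (\<Sum>q<J. m ^ q) + m ^ J * N J)"
    by (simp only: of_nat_add of_nat_mult of_nat_power of_nat_sum m_def N_def)
  also have "\<dots> \<le> real s + real ((t + 2) choose 2) * (real s * (1 + m) + m\<^sup>2 * N 2)"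
    using cover_bound_antimono[of J] J k_ge by (simp add: P_def)
  also have "\<dots> < lower + real s" using two_cover_bound by simp
  finally show ?thesis .
qed

text \<open>Inside \<open>W\<close> the two traces share only \<open>t - 1\<close> points, so a
  further common point lies outside.\<close>

lemma meets_outside:
  assumes "finite W" "card W = t + 1" "w \<in> W" "z \<in> W" "w \<noteq> z"
    "A \<inter> W = W - {w}" "B \<inter> W = W - {z}" "t \<le> card (A \<inter> B)"
  shows "A \<inter> (B - W) \<noteq> {}"
proof
  assume "A \<inter> (B - W) = {}"
  then have "A \<inter> B \<subseteq> W - {w, z}" using assms(6,7) by blast
  then have "card (A \<inter> B) \<le> card (W - {w, z})" using assms(1) by (intro card_mono) auto
  also have "\<dots> = t - 1" using assms by (simp add: card_Diff_subset)
  finally show False using assms(8) t_pos by linarith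
qed

lemma inter_cover_cases:
  assumes "finite W" "card W = t + 1" "t \<le> card (A \<inter> W)"
  obtains "W \<subseteq> A" | w where "w \<in> W" "A \<inter> W = W - {w}"
proof (cases "W \<subseteq> A")
  case False
  then have "card (W - A) = 1"
    using assms card_Diff_subset_Int[of W A] psubset_card_mono[of W "A \<inter> W"]
    by (simp add: Int_commute) force
  then obtain w where "W - A = {w}" by (auto simp: card_1_singleton_iff)
  then show ?thesis using that(2)[of w] by blast
qed (use that in blast)

lemma card_disturbing_Un_le:
  assumes "G \<in> \<F>" "G' \<in> \<F>"
  shows "card ({B \<in> \<F>. card (B \<inter> G) < t} \<union> {B \<in> \<F>. card (B \<inter> G') < t}) \<le> 2 * s"
  using card_Un_le[of "{B \<in> \<F>. card (B \<inter> G) < t}" "{B \<in> \<F>. card (B \<inter> G') < t}"]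
    card_disturbing_le[OF assms(1)] card_disturbing_le[OF assms(2)] by linarith

text \<open>Take \<open>G\<close>, \<open>G'\<close> with \<open>card (G \<inter> G') < t\<close>; they are disjoint outside \<open>W\<close>. A point \<open>v\<close> common
  to all members with the trace of \<open>G\<close> lies outside \<open>G'\<close>, so these members contain \<open>v\<close> and a second
  point, of \<open>G'\<close>, and are few. If this happened for \<open>G'\<close> as well, the family would be too small.\<close>

lemma obtain_uncovered_trace:
  assumes W: "finite W" "card W = t + 1" "\<And>A. A \<in> \<F> \<Longrightarrow> t \<le> card (A \<inter> W)"
    and large: "lower + real s \<le> real (card \<F>)"
  obtains y A where "y \<in> W" "A \<in> \<F>" "A \<inter> W = W - {y}"
    "\<And>v. v \<notin> W \<Longrightarrow> \<exists>A\<in>\<F>. A \<inter> W = W - {y} \<and> v \<notin> A"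
proof -
  obtain G G' where G: "G \<in> \<F>" "G' \<in> \<F>" "card (G \<inter> G') < t"
    using not_intersecting by (auto simp: t_intersecting_def not_le)
  note fin = memD(1)[OF G(1)] memD(1)[OF G(2)]
  have "\<not> W \<subseteq> G"
  proof
    assume "W \<subseteq> G"
    then have "card (G' \<inter> W) \<le> card (G \<inter> G')" using fin by (intro card_mono) auto
    then show False using W(3)[OF G(2)] G(3) by linarith
  qed
  then obtain x where x: "x \<in> W" "G \<inter> W = W - {x}"
    using inter_cover_cases[OF W(1,2) W(3)[OF G(1)]] by blast
  have "\<not> W \<subseteq> G'"
  proof
    assume "W \<subseteq> G'"
    then have "card (G \<inter> W) \<le> card (G \<inter> G')" using fin by (intro card_mono) auto
    then show False using W(3)[OF G(1)] G(3) by linarith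
  qed
  then obtain y where y: "y \<in> W" "G' \<inter> W = W - {y}"
    using inter_cover_cases[OF W(1,2) W(3)[OF G(2)]] by blast
  have sub: "W - {x, y} \<subseteq> G \<inter> G'" using x y by blast
  have "x \<noteq> y"
  proof
    assume "x = y"
    then have "card (W - {x}) \<le> card (G \<inter> G')" using x y fin by (intro card_mono) auto
    then show False using W x(1) G(3) by simp
  qed
  then have cxy: "card (W - {x, y}) = t - 1" using W x y by (simp add: card_Diff_subset)
  \<comment> \<open>\<open>G \<inter> G'\<close> has at most \<open>t - 1\<close> points and
    contains the \<open>t - 1\<close> points of \<open>W - {x, y}\<close>, so it equals that
    set.\<close>
  then have disj: "G \<inter> G' \<subseteq> W"
    using card_seteq[of "G \<inter> G'" "W - {x, y}"] sub fin G(3) by auto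
  have cG: "card (G - W) = k - t" "card (G' - W) = k - t"
    using x y W memD[OF G(1)] memD[OF G(2)] by (simp_all add: card_Diff_subset_Int)
  have "\<exists>z\<in>{x, y}. \<forall>v. v \<notin> W \<longrightarrow> (\<exists>A\<in>\<F>. A \<inter> W = W - {z} \<and> v \<notin> A)"
  proof (rule ccontr)
    assume "\<not> ?thesis"
    then have covered: "\<exists>v. v \<notin> W \<and> (\<forall>A\<in>\<F>. A \<inter> W = W - {z} \<longrightarrow> v \<in> A)" if "z \<in> {x, y}" for z
      using that by meson
    obtain v where v: "v \<notin> W" "\<And>A. A \<in> \<F> \<Longrightarrow> A \<inter> W = W - {x} \<Longrightarrow> v \<in> A"
      using covered[of x] by auto
    obtain v' where v': "v' \<notin> W" "\<And>A. A \<in> \<F> \<Longrightarrow> A \<inter> W = W - {y} \<Longrightarrow> v' \<in> A"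
      using covered[of y] by auto
    have vG: "v \<notin> G'" "v' \<notin> G"
      using v(1) v(2)[OF G(1) x(2)] v'(1) v'(2)[OF G(2) y(2)] disj by auto
    \<comment> \<open>The members are sorted by the point of \<open>W\<close> they miss: none
      (\<open>P\<close>), \<open>x\<close> (\<open>Px\<close>), \<open>y\<close> (\<open>Py\<close>)
      or another (\<open>Q\<close>). Those in \<open>Px\<close>, \<open>Py\<close> and
      \<open>Q\<close> avoid \<open>D\<close>, so they meet \<open>G\<close> and \<open>G'\<close>
      in at least \<open>t\<close> points each.\<close>
    define D where "D = {B \<in> \<F>. card (B \<inter> G) < t} \<union> {B \<in> \<F>. card (B \<inter> G') < t}"
    define P where "P = {A \<in> \<F>. W \<subseteq> A}"
    define Px where "Px = {A \<in> \<F> - D. A \<inter> W = W - {x}}"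
    define Py where "Py = {A \<in> \<F> - D. A \<inter> W = W - {y}}"
    define Q where "Q = {A \<in> \<F> - D. \<exists>w\<in>W - {x, y}. A \<inter> W = W - {w}}"
    let ?c1 = "(n - (t + 1)) choose (k - (t + 1))" and ?c2 = "(n - (t + 2)) choose (k - (t + 2))"
    have notD: "t \<le> card (A \<inter> G)" "t \<le> card (A \<inter> G')" if "A \<in> \<F> - D" for A
      using that by (auto simp: D_def not_less)
    have "card P \<le> ?c1" unfolding P_def using W by (intro card_star_le) auto
    moreover have "card D \<le> 2 * s" unfolding D_def by (rule card_disturbing_Un_le[OF G(1,2)])
    moreover have "card Px \<le> card (G' - W) * ?c2"
    proof (rule card_UNION_le_mult)
      show "Px \<subseteq> (\<Union>g\<in>G' - W. {A \<in> \<F>. insert g (insert v (W - {x})) \<subseteq> A})"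
      proof
        fix A assume "A \<in> Px"
        then have A: "A \<in> \<F> - D" "A \<inter> W = W - {x}" by (auto simp: Px_def)
        then obtain g where "g \<in> A" "g \<in> G' - W"
          using meets_outside[OF W(1,2) x(1) y(1) \<open>x \<noteq> y\<close> A(2) y(2) notD(2)[OF A(1)]] by blast
        then show "A \<in> (\<Union>g\<in>G' - W. {A \<in> \<F>. insert g (insert v (W - {x})) \<subseteq> A})"
          using A v(2) by blast
      qed
      \<comment> \<open>\<open>v\<close> lies outside \<open>G'\<close>, so
        \<open>g \<noteq> v\<close> and \<open>t + 2\<close> points are prescribed.\<close>
      show "card {A \<in> \<F>. insert g (insert v (W - {x})) \<subseteq> A} \<le> ?c2" if "g \<in> G' - W" for g
        using that vG v(1) W x(1) by (intro card_star_le) (auto simp: card_insert_if)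
    qed (use fin finite_family in auto)
    moreover have "card Py \<le> card (G - W) * ?c2"
    proof (rule card_UNION_le_mult)
      show "Py \<subseteq> (\<Union>g\<in>G - W. {A \<in> \<F>. insert g (insert v' (W - {y})) \<subseteq> A})"
      proof
        fix A assume "A \<in> Py"
        then have A: "A \<in> \<F> - D" "A \<inter> W = W - {y}" by (auto simp: Py_def)
        then obtain g where "g \<in> A" "g \<in> G - W"
          using meets_outside[OF W(1,2) y(1) x(1) \<open>x \<noteq> y\<close>[symmetric] A(2) x(2) notD(1)[OF A(1)]] by blast
        then show "A \<in> (\<Union>g\<in>G - W. {A \<in> \<F>. insert g (insert v' (W - {y})) \<subseteq> A})"
          using A v'(2) by blast
      qed
      show "card {A \<in> \<F>. insert g (insert v' (W - {y})) \<subseteq> A} \<le> ?c2" if "g \<in> G - W" for g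
        using that vG v'(1) W y(1) by (intro card_star_le) (auto simp: card_insert_if)
    qed (use fin finite_family in auto)
    \<comment> \<open>A member missing a third point \<open>w\<close> has a point in each of the
      disjoint sets \<open>G - W\<close> and \<open>G' - W\<close>, again \<open>t + 2\<close>
      prescribed points.\<close>
    moreover have "card Q \<le> card ((W - {x, y}) \<times> (G - W) \<times> (G' - W)) * ?c2"
    proof (rule card_UNION_le_mult)
      show "Q \<subseteq> (\<Union>(w, g, g')\<in>(W - {x, y}) \<times> (G - W) \<times> (G' - W).
          {A \<in> \<F>. insert g (insert g' (W - {w})) \<subseteq> A})"
      proof
        fix A assume "A \<in> Q"
        then obtain w where w: "w \<in> W - {x, y}" "A \<inter> W = W - {w}" and A: "A \<in> \<F> - D"
          by (auto simp: Q_def)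
        obtain g where "g \<in> A" "g \<in> G - W"
          using meets_outside[OF W(1,2) _ x(1) _ w(2) x(2) notD(1)[OF A]] w(1) by blast
        moreover obtain g' where "g' \<in> A" "g' \<in> G' - W"
          using meets_outside[OF W(1,2) _ y(1) _ w(2) y(2) notD(2)[OF A]] w(1) by blast
        ultimately show "A \<in> (\<Union>(w, g, g')\<in>(W - {x, y}) \<times> (G - W) \<times> (G' - W).
          {A \<in> \<F>. insert g (insert g' (W - {w})) \<subseteq> A})"
          using A w by (intro UN_I[of "(w, g, g')"]) auto
      qed
      fix p assume p: "p \<in> (W - {x, y}) \<times> (G - W) \<times> (G' - W)"
      obtain w g g' where pe: "p = (w, g, g')" by (cases p) auto
      then have "g \<noteq> g'" using p disj by auto
      then have "card {A \<in> \<F>. insert g (insert g' (W - {w})) \<subseteq> A} \<le> ?c2"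
        using p pe W by (intro card_star_le) (auto simp: card_insert_if)
      then show "card (case p of (w, g, g') \<Rightarrow> {A \<in> \<F>. insert g (insert g' (W - {w})) \<subseteq> A}) \<le> ?c2"
        by (simp add: pe)
    qed (use W fin finite_family in auto)
    moreover have "card \<F> \<le> card P + card D + card Px + card Py + card Q"
    proof -
      have "\<F> \<subseteq> P \<union> D \<union> Px \<union> Py \<union> Q"
      proof
        fix A assume A: "A \<in> \<F>"
        show "A \<in> P \<union> D \<union> Px \<union> Py \<union> Q"
          by (rule inter_cover_cases[OF W(1,2) W(3)[OF A]])
            (use A in \<open>auto simp: P_def Px_def Py_def Q_def\<close>)
      qed
      moreover have "finite (P \<union> D \<union> Px \<union> Py \<union> Q)"
        using finite_family by (auto simp: P_def D_def Px_def Py_def Q_def)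
      ultimately have "card \<F> \<le> card (P \<union> D \<union> Px \<union> Py \<union> Q)" by (rule card_mono[rotated])
      also have "\<dots> \<le> card P + card D + card Px + card Py + card Q"
        by (intro order.trans[OF card_Un_le] add_mono order.refl)
      finally show ?thesis .
    qed
    ultimately have "card \<F> \<le> ?c1 + 2 * s + 2 * (k - t) * ?c2 + (t - 1) * (k - t)\<^sup>2 * ?c2"
      by (simp add: cG cxy card_cartesian_product power2_eq_square)
    then have "real (card \<F>) \<le> real (?c1 + 2 * s + 2 * (k - t) * ?c2 + (t - 1) * (k - t)\<^sup>2 * ?c2)"
      by (simp only: of_nat_le_iff)
    also have "\<dots> = N 1 + 2 * real s + 2 * (m - 1) * N 2 + (real t - 1) * (m - 1)\<^sup>2 * N 2"
      unfolding m_diff N_def using t_pos by (simp add: of_nat_diff)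
    finally show False using both_covered_bound large by linarith
  qed
  then show thesis using that x y G by blast
qed

text \<open>An exceptional member misses some \<open>w \<noteq> y\<close> of \<open>W\<close>, so
  unless it disturbs \<open>A0\<close> it has a point \<open>a\<close> in \<open>A0 - W\<close>.
  Some \<open>A\<close> with trace \<open>W - {y}\<close> avoids \<open>a\<close>, and branching
  along \<open>A\<close> gives a second point \<open>b \<noteq> a\<close>. Then
  \<open>W - {w}\<close>, \<open>a\<close> and \<open>b\<close> are \<open>t + 2\<close> prescribed
  points, with \<open>t\<close> choices for \<open>w\<close>.\<close>

lemma card_not_containing_le:
  assumes W: "finite W" "card W = t + 1" "\<And>A. A \<in> \<F> \<Longrightarrow> t \<le> card (A \<inter> W)"
    and y: "y \<in> W" "A0 \<in> \<F>" "A0 \<inter> W = W - {y}"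
      "\<And>v. v \<notin> W \<Longrightarrow> \<exists>A\<in>\<F>. A \<inter> W = W - {y} \<and> v \<notin> A"
  shows "card {A \<in> \<F>. \<not> W - {y} \<subseteq> A}
    \<le> s + (k - t) * (s + (k - t) * (t * ((n - (t + 2)) choose (k - (t + 2)))))"
proof -
  let ?E = "{A \<in> \<F>. \<not> W - {y} \<subseteq> A}"
  have trace: "\<exists>w\<in>W - {y}. B \<inter> W = W - {w}" if "B \<in> ?E" for B
    by (rule inter_cover_cases[OF W(1,2) W(3)[of B]]) (use that in auto)
  have card_out: "card (A - W) = k - t" if "A \<in> \<F>" "A \<inter> W = W - {y}" for A
    using that y(1) W memD[OF that(1)] by (simp add: card_Diff_subset_Int)
  have meet: "B \<inter> (A - W) \<noteq> {}"
    if "B \<in> ?E" "A \<in> \<F>" "A \<inter> W = W - {y}" "t \<le> card (B \<inter> A)" for A B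
    using trace[OF that(1)] meets_outside[OF W(1,2) _ y(1) _ _ that(3,4)] by blast
  have "card ?E \<le> s + card (A0 - W) * (s + (k - t) * (t * ((n - (t + 2)) choose (k - (t + 2)))))"
  proof (rule card_le_mult_star[OF y(2)])
    fix a assume a: "a \<in> A0 - W"
    then obtain A where A: "A \<in> \<F>" "A \<inter> W = W - {y}" "a \<notin> A" using y(4) by blast
    have "card {B \<in> ?E. a \<in> B} \<le> s + card (A - W) * (t * ((n - (t + 2)) choose (k - (t + 2))))"
    proof (rule card_le_mult_star[OF A(1)])
      fix b assume b: "b \<in> A - W"
      have "card {B \<in> {B \<in> ?E. a \<in> B}. b \<in> B}
        \<le> card (W - {y}) * ((n - (t + 2)) choose (k - (t + 2)))"
      proof (rule card_UNION_le_mult)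
        show "{B \<in> {B \<in> ?E. a \<in> B}. b \<in> B}
          \<subseteq> (\<Union>w\<in>W - {y}. {B \<in> \<F>. insert a (insert b (W - {w})) \<subseteq> B})"
        proof
          fix B assume B: "B \<in> {B \<in> {B \<in> ?E. a \<in> B}. b \<in> B}"
          then obtain w where "w \<in> W - {y}" "B \<inter> W = W - {w}" using trace by blast
          then show "B \<in> (\<Union>w\<in>W - {y}. {B \<in> \<F>. insert a (insert b (W - {w})) \<subseteq> B})"
            using B by blast
        qed
        show "card {B \<in> \<F>. insert a (insert b (W - {w})) \<subseteq> B} \<le> (n - (t + 2)) choose (k - (t + 2))"
          if "w \<in> W - {y}" for w
          using that a b A(3) W by (intro card_star_le) (auto simp: card_insert_if)
      qed (use W finite_family in auto)
      then show "card {B \<in> {B \<in> ?E. a \<in> B}. b \<in> B} \<le> t * ((n - (t + 2)) choose (k - (t + 2)))"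
        using W y(1) by simp
    qed (use A meet memD(1) in auto)
    then show "card {B \<in> ?E. a \<in> B} \<le> s + (k - t) * (t * ((n - (t + 2)) choose (k - (t + 2))))"
      using card_out[OF A(1,2)] by simp
  qed (use y meet memD(1) in auto)
  then show ?thesis using card_out[OF y(2,3)] by simp
qed

text \<open>Members containing \<open>T\<close> branch along \<open>E0 - T\<close>. A point of
  \<open>I\<close> is charged a full star; any other point is missed by some exceptional
  \<open>A\<close>, and a second branching along \<open>A - T\<close> replaces its star by smaller
  ones.\<close>

lemma card_star_le_common:
  assumes T: "finite T" "card T = t" "\<And>A. A \<in> \<F> \<Longrightarrow> \<not> T \<subseteq> A \<Longrightarrow> card (A - T) = k - t + 1"
    and E0: "E0 \<in> \<F>" "\<not> T \<subseteq> E0"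
    and I: "I = (\<Inter>A\<in>{A \<in> \<F>. \<not> T \<subseteq> A}. A - T)"
  shows "card {A \<in> \<F>. T \<subseteq> A} \<le> s + (card I * ((n - (t + 1)) choose (k - (t + 1)))
    + (k - t + 1 - card I) * (s + (k - t + 1) * ((n - (t + 2)) choose (k - (t + 2)))))"
proof -
  let ?S = "{A \<in> \<F>. T \<subseteq> A}" and ?c1 = "(n - (t + 1)) choose (k - (t + 1))"
    and ?c2 = "(n - (t + 2)) choose (k - (t + 2))"
  have sub: "I \<subseteq> E0 - T" using I E0 by blast
  have fin: "finite (E0 - T)" using memD(1)[OF E0(1)] by simp
  have meet: "B \<inter> (A - T) \<noteq> {}" if "A \<in> \<F>" "\<not> T \<subseteq> A" "t \<le> card (B \<inter> A)" for A B
    using meets_large_subset[OF that(1) _ _ that(3), of "A - T"] T(3)[OF that(1,2)] by simp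
  have "card ?S \<le> s + (\<Sum>v\<in>E0 - T. card {B \<in> ?S. v \<in> B})"
    by (rule card_le_sum_star[OF E0(1)]) (use fin meet E0 in auto)
  also have "(\<Sum>v\<in>E0 - T. card {B \<in> ?S. v \<in> B})
    = (\<Sum>v\<in>I. card {B \<in> ?S. v \<in> B}) + (\<Sum>v\<in>(E0 - T) - I. card {B \<in> ?S. v \<in> B})"
    using sum.subset_diff[OF sub fin] by (simp add: add.commute)
  also have "(\<Sum>v\<in>I. card {B \<in> ?S. v \<in> B}) \<le> card I * ?c1"
  proof (rule sum_bounded_above[where 'a = nat, simplified])
    fix v assume v: "v \<in> I"
    have "{B \<in> ?S. v \<in> B} = {B \<in> \<F>. insert v T \<subseteq> B}" by auto
    moreover have "v \<notin> T" using v sub by auto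
    ultimately show "card {B \<in> ?S. v \<in> B} \<le> ?c1" using T by (simp only:) (rule card_star_le, auto)
  qed
  also have "(\<Sum>v\<in>(E0 - T) - I. card {B \<in> ?S. v \<in> B}) \<le> card ((E0 - T) - I) * (s + (k - t + 1) * ?c2)"
  proof (rule sum_bounded_above[where 'a = nat, simplified])
    fix v assume v: "v \<in> (E0 - T) - I"
    then obtain A where A: "A \<in> \<F>" "\<not> T \<subseteq> A" "v \<notin> A" using I by blast
    have "card {B \<in> ?S. v \<in> B} \<le> s + card (A - T) * ?c2"
    proof (rule card_le_mult_star[OF A(1)])
      fix b assume b: "b \<in> A - T"
      have "{B \<in> {B \<in> ?S. v \<in> B}. b \<in> B} = {B \<in> \<F>. insert b (insert v T) \<subseteq> B}" by auto
      moreover have "card (insert b (insert v T)) = t + 2"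
        using b v A(3) T by (auto simp: card_insert_if)
      ultimately show "card {B \<in> {B \<in> ?S. v \<in> B}. b \<in> B} \<le> ?c2"
        using T(1) card_star_le[of "insert b (insert v T)" "t + 2"] by simp
    qed (use A meet memD(1) in auto)
    then show "card {B \<in> ?S. v \<in> B} \<le> s + (k - t + 1) * ?c2" using T(3)[OF A(1,2)] by simp
  qed
  also have "card ((E0 - T) - I) = k - t + 1 - card I"
    using sub fin T(3)[OF E0] by (simp add: card_Diff_subset finite_subset)
  finally show ?thesis by simp
qed

text \<open>\<open>T - {w}\<close> together with three points of \<open>I\<close> has
  \<open>t + 2\<close> points; this fixes the threshold 3.\<close>

lemma card_not_containing_le_common:
  assumes T: "finite T" "card T = t" "\<And>A. A \<in> \<F> \<Longrightarrow> \<not> T \<subseteq> A \<Longrightarrow> \<exists>w\<in>T. T - {w} \<subseteq> A"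
    and I: "I = (\<Inter>A\<in>{A \<in> \<F>. \<not> T \<subseteq> A}. A - T)" "3 \<le> card I" "I \<inter> T = {}"
  shows "card {A \<in> \<F>. \<not> T \<subseteq> A} \<le> t * ((n - (t + 2)) choose (k - (t + 2)))"
proof -
  obtain K where K: "K \<subseteq> I" "card K = 3" "finite K"
    using I(2) by (rule obtain_subset_with_card_n)
  have "card {A \<in> \<F>. \<not> T \<subseteq> A} \<le> card T * ((n - (t + 2)) choose (k - (t + 2)))"
  proof (rule card_UNION_le_mult)
    show "{A \<in> \<F>. \<not> T \<subseteq> A} \<subseteq> (\<Union>w\<in>T. {A \<in> \<F>. (T - {w}) \<union> K \<subseteq> A})"
    proof
      fix A assume A: "A \<in> {A \<in> \<F>. \<not> T \<subseteq> A}"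
      then have "K \<subseteq> A" using K(1) I(1) by blast
      then show "A \<in> (\<Union>w\<in>T. {A \<in> \<F>. (T - {w}) \<union> K \<subseteq> A})" using A T(3)[of A] by auto
    qed
    fix w assume w: "w \<in> T"
    have "card ((T - {w}) \<union> K) = card (T - {w}) + card K"
      using K I(3) T(1) by (intro card_Un_disjoint) auto
    then show "card {A \<in> \<F>. (T - {w}) \<union> K \<subseteq> A} \<le> (n - (t + 2)) choose (k - (t + 2))"
      using T K w t_pos by (intro card_star_le) auto
  qed (use T finite_family in auto)
  then show ?thesis by (simp only: T(2))
qed

text \<open>For exceptional \<open>A\<close> the set \<open>A - T\<close> has
  \<open>k - t + 1\<close> points and contains \<open>I\<close>. Once \<open>I\<close> has that size
  too, all these sets equal \<open>I\<close>, and \<open>Z = T \<union> I\<close> has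
  \<open>k + 1\<close> points.\<close>

lemma obtain_center:
  assumes large: "lower + real s \<le> real (card \<F>)"
  obtains T Z where "T \<subseteq> Z" "Z \<subseteq> {1..n}" "card T = t" "card Z = k + 1"
    "\<And>A. A \<in> \<F> \<Longrightarrow> T \<subseteq> A \<or> A \<subseteq> Z"
proof -
  obtain W where W: "finite W" "card W = t + 1" "\<And>A. A \<in> \<F> \<Longrightarrow> t \<le> card (A \<inter> W)"
    using no_small_cover_bound large by (meson not_le)
  obtain y A0 where y: "y \<in> W" "A0 \<in> \<F>" "A0 \<inter> W = W - {y}"
    "\<And>v. v \<notin> W \<Longrightarrow> \<exists>A\<in>\<F>. A \<inter> W = W - {y} \<and> v \<notin> A"
    using obtain_uncovered_trace[OF W large] by blast
  define T where "T = W - {y}"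
  have T: "finite T" "card T = t" using W y(1) by (auto simp: T_def)
  have trace: "\<exists>w\<in>T. A \<inter> T = T - {w}" if "A \<in> \<F>" "\<not> T \<subseteq> A" for A
    by (rule inter_cover_cases[OF W(1,2) W(3)[OF that(1)]]) (use that in \<open>auto simp: T_def\<close>)
  have card_out: "card (A - T) = k - t + 1" if A: "A \<in> \<F>" "\<not> T \<subseteq> A" for A
  proof -
    obtain w where "w \<in> T" "A \<inter> T = T - {w}" using trace[OF A] by blast
    then show ?thesis using T memD[OF A(1)] t_pos k_ge by (simp add: card_Diff_subset_Int)
  qed
  obtain E0 where E0: "E0 \<in> \<F>" "\<not> T \<subseteq> E0"
  proof -
    obtain G G' where G: "G \<in> \<F>" "G' \<in> \<F>" "card (G \<inter> G') < t"
      using not_intersecting by (auto simp: t_intersecting_def not_le)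
    \<comment> \<open>Two members that both contain \<open>T\<close> meet in at least
      \<open>t\<close> points, so \<open>G\<close> or \<open>G'\<close> is exceptional.\<close>
    have "\<not> T \<subseteq> G \<inter> G'"
      using G T card_mono[of "G \<inter> G'" T] memD(1)[OF G(1)] by auto
    then show ?thesis using G that by blast
  qed
  define I where "I = (\<Inter>A\<in>{A \<in> \<F>. \<not> T \<subseteq> A}. A - T)"
  let ?c1 = "(n - (t + 1)) choose (k - (t + 1))" and ?c2 = "(n - (t + 2)) choose (k - (t + 2))"
  let ?E = "{A \<in> \<F>. \<not> T \<subseteq> A}" and ?S = "{A \<in> \<F>. T \<subseteq> A}"
  have I: "I \<subseteq> E0 - T" using E0 by (auto simp: I_def)
  have fin: "finite (E0 - T)" using memD(1)[OF E0(1)] by simp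
  have cI: "card I \<le> k - t + 1" using card_mono[OF fin I] card_out[OF E0] by simp
  have "card ?S \<le> s + (card I * ?c1 + (k - t + 1 - card I) * (s + (k - t + 1) * ?c2))"
    using card_star_le_common[OF T card_out E0 I_def] .
  then have "real (card ?S) \<le> real (s + (card I * ?c1 + (k - t + 1 - card I) * (s + (k - t + 1) * ?c2)))"
    by (simp only: of_nat_le_iff)
  also have "\<dots> = real s + (real (card I) * N 1 + (m - real (card I)) * (real s + m * N 2))"
    by (simp only: of_nat_add of_nat_mult of_nat_diff[OF cI] m_def N_def)
  finally have S: "real (card ?S) \<le> real s + (real (card I) * N 1 + (m - real (card I)) * (real s + m * N 2))" .
  \<comment> \<open>The bound grows with \<open>card I\<close>, so the values \<open>k - t\<close>
    and 2 represent the two cases below.\<close>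
  have mono: "real (card I) * N 1 + (m - real (card I)) * (real s + m * N 2)
      \<le> i * N 1 + (m - i) * (real s + m * N 2)" if "real (card I) \<le> i" for i
  proof -
    have "(i - real (card I)) * (real s + m * N 2) \<le> (i - real (card I)) * N 1"
      using that s_m_N2_le by (intro mult_left_mono) auto
    then show ?thesis by (simp add: algebra_simps)
  qed
  have card_F: "card \<F> \<le> card ?S + card ?E"
  proof -
    have "card \<F> = card (?S \<union> ?E)" by (rule arg_cong[where f = card]) auto
    then show ?thesis using card_Un_le[of ?S ?E] by simp
  qed
  have "card I = k - t + 1"
  proof (rule ccontr)
    assume "card I \<noteq> k - t + 1"
    then have less: "card I \<le> k - t" using cI by simp
    show False
    proof (cases "3 \<le> card I")
      case True
      have "card ?E \<le> t * ?c2"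
        by (rule card_not_containing_le_common[OF T _ I_def True]) (use trace I in fastforce)+
      then have "real (card ?E) \<le> real (t * ?c2)" by (simp only: of_nat_le_iff)
      then have "real (card ?E) \<le> real t * N 2" by (simp add: N_def)
      moreover have "real (card ?S) \<le> real s + ((m - 1) * N 1 + 1 * (real s + m * N 2))"
      proof -
        have "real (card I) \<le> m - 1" using less by (simp add: m_diff)
        from mono[OF this] S show ?thesis by simp
      qed
      ultimately show False using large_intersection_bound large card_F by simp
    next
      case False
      have "card ?E \<le> s + (k - t) * (s + (k - t) * (t * ?c2))"
        using card_not_containing_le[OF W y] by (simp add: T_def)
      then have "real (card ?E) \<le> real (s + (k - t) * (s + (k - t) * (t * ?c2)))" by (simp only: of_nat_le_iff)
      also have "\<dots> = real s + (m - 1) * real s + real t * (m - 1)\<^sup>2 * N 2"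
        by (simp only: m_diff N_def of_nat_add of_nat_mult power2_eq_square distrib_left ac_simps)
      finally have "real (card ?E) \<le> real s + (m - 1) * real s + real t * (m - 1)\<^sup>2 * N 2" .
      moreover have "real (card ?S) \<le> real s + (2 * N 1 + (m - 2) * (real s + m * N 2))"
        using S mono[of 2] False by simp
      ultimately show False using small_intersection_bound large card_F by simp
    qed
  qed
  then have same: "A - T = I" if "A \<in> \<F>" "\<not> T \<subseteq> A" for A
  proof -
    have "I \<subseteq> A - T" using that unfolding I_def by blast
    then show ?thesis
      using card_seteq[of "A - T" I] card_out[OF that] \<open>card I = k - t + 1\<close> memD(1)[OF that(1)] by simp
  qed
  show thesis
  proof (rule that[of T "T \<union> I"])
    show "T \<union> I \<subseteq> {1..n}"
      using y memD(3)[OF y(2)] I memD(3)[OF E0(1)] unfolding T_def by blast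
    have "card (T \<union> I) = card T + card I"
      using T I fin finite_subset by (intro card_Un_disjoint) auto
    then show "card (T \<union> I) = k + 1"
      using T(2) \<open>card I = k - t + 1\<close> k_ge by simp
    show "T \<subseteq> A \<or> A \<subseteq> T \<union> I" if "A \<in> \<F>" for A using same[OF that] by blast
  qed (use T in auto)
qed

end

section \<open>The extremal families\<close>

text \<open>Bonferroni's inequality by induction: a new set overlaps the union of the earlier ones
  in at most \<open>card V * b\<close> elements.\<close>

lemma mult_card_le_card_UNION:
  fixes a b :: nat
  assumes "finite V" "\<And>v. v \<in> V \<Longrightarrow> finite (S v)" "\<And>v. v \<in> V \<Longrightarrow> card (S v) = a"
    and "\<And>v w. v \<in> V \<Longrightarrow> w \<in> V \<Longrightarrow> v \<noteq> w \<Longrightarrow> card (S v \<inter> S w) \<le> b"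
  shows "card V * a \<le> card (\<Union>v\<in>V. S v) + (card V choose 2) * b"
  using assms
proof (induction V rule: finite_induct)
  case (insert x V)
  let ?U = "\<Union>v\<in>V. S v"
  have "card (S x \<inter> ?U) \<le> card V * b"
    using insert.prems insert.hyps
    by (intro card_UNION_le_mult[where B = "\<lambda>v. S x \<inter> S v"]) auto
  moreover have "card (S x) + card ?U = card (S x \<union> ?U) + card (S x \<inter> ?U)"
    using insert by (intro card_Un_Int) auto
  moreover have "card V * a \<le> card ?U + (card V choose 2) * b"
    using insert by auto
  moreover have "(Suc (card V) choose 2) * b = card V * b + (card V choose 2) * b"
    by (simp add: numeral_2_eq_2 distrib_right)
  ultimately show ?case using insert by simp
qed simp

lemma obtain_flag_permutation:
  assumes "T \<subseteq> Z" "Z \<subseteq> {1..n}" "card T = t" "card Z = u"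
  obtains \<pi> where "\<pi> permutes {1..n}" "\<pi> ` T = {1..t}" "\<pi> ` Z = {1..u}"
proof -
  have fin: "finite Z" "finite T" using assms finite_subset by (meson finite_atLeastAtMost)+
  have le: "t \<le> u" "u \<le> n"
    using card_mono[OF fin(1) assms(1)] card_mono[OF _ assms(2)] assms by auto
  obtain f where f: "bij_betw f T {1..t}"
    using finite_same_card_bij[OF fin(2), of "{1..t}"] assms(3) by auto
  obtain g where g: "bij_betw g (Z - T) {t + 1..u}"
    using finite_same_card_bij[of "Z - T" "{t + 1..u}"] fin assms by (auto simp: card_Diff_subset)
  obtain h where h: "bij_betw h ({1..n} - Z) {u + 1..n}"
    using finite_same_card_bij[of "{1..n} - Z" "{u + 1..n}"] fin assms by (auto simp: card_Diff_subset)
  define \<pi> where "\<pi> x = (if x \<in> T then f x else if x \<in> Z then g x else if x \<in> {1..n} then h x else x)" for x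
  have 1: "bij_betw \<pi> T {1..t}"
    using f by (rule bij_betw_cong[THEN iffD1, rotated]) (simp add: \<pi>_def)
  have 2: "bij_betw \<pi> (Z - T) {t + 1..u}"
    using g by (rule bij_betw_cong[THEN iffD1, rotated]) (simp add: \<pi>_def)
  have 3: "bij_betw \<pi> ({1..n} - Z) {u + 1..n}"
    using h by (rule bij_betw_cong[THEN iffD1, rotated]) (use assms(1) in \<open>auto simp: \<pi>_def\<close>)
  have "bij_betw \<pi> (T \<union> (Z - T)) ({1..t} \<union> {t + 1..u})"
    by (rule bij_betw_combine[OF 1 2]) auto
  moreover have "T \<union> (Z - T) = Z" "{1..t} \<union> {t + 1..u} = {1..u}" using assms(1) le by auto
  ultimately have 4: "bij_betw \<pi> Z {1..u}" by simp
  have "bij_betw \<pi> (Z \<union> ({1..n} - Z)) ({1..u} \<union> {u + 1..n})"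
    by (rule bij_betw_combine[OF 4 3]) auto
  moreover have "Z \<union> ({1..n} - Z) = {1..n}" "{1..u} \<union> {u + 1..n} = {1..n}" using assms(2) le by auto
  ultimately have "bij_betw \<pi> {1..n} {1..n}" by simp
  then have "\<pi> permutes {1..n}"
    by (rule bij_imp_permutes) (use assms in \<open>auto simp: \<pi>_def\<close>)
  then show thesis using that 1 4 by (simp add: bij_betw_def)
qed

lemma nsets_minus_one:
  assumes "finite Z" "card Z = k + 1" "B \<subseteq> Z" "card B = k" "\<not> T \<subseteq> B" "T \<subseteq> Z"
  obtains z where "z \<in> T" "B = Z - {z}"
proof -
  have "card (Z - B) = 1" using assms finite_subset[of B Z] by (simp add: card_Diff_subset)
  then obtain z where z: "Z - B = {z}" by (auto simp: card_1_singleton_iff)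
  obtain x where x: "x \<in> T" "x \<notin> B" using assms(5) by blast
  then have "x \<in> Z - B" using assms(6) by blast
  then have "z \<in> T" using x z by simp
  moreover have "B = Z - (Z - B)" using assms(3) by blast
  then have "B = Z - {z}" by (simp only: z)
  ultimately show thesis by (rule that)
qed

text \<open>The pair \<open>T \<subseteq> Z\<close> plays the role of \<open>{1..t}\<close> and
  \<open>{1..k+1}\<close>. Leaving it arbitrary serves both the construction on these intervals and
  the centre found in a given family.\<close>

locale flag =
  fixes k t :: nat and T Z :: "nat set"
  assumes finite_Z: "finite Z" and T_sub: "T \<subseteq> Z" and card_T: "card T = t" and card_Z: "card Z = k + 1"
    and t_pos: "0 < t" and t_less: "t < k"
begin

lemma finite_T: "finite T"
  using T_sub finite_Z finite_subset by blast

lemma card_Int_contain: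
  assumes "finite A" "T \<subseteq> A" "T \<subseteq> B"
  shows "t \<le> card (A \<inter> B)"
  using card_mono[of "A \<inter> B" T] assms card_T by auto

lemma card_Int_minus_one:
  assumes "t + 1 \<le> card (A \<inter> Z)"
  shows "t \<le> card (A \<inter> (Z - {z}))"
proof -
  have "card (A \<inter> Z) - 1 \<le> card (A \<inter> Z - {z})"
    using diff_card_le_card_Diff[of "{z}" "A \<inter> Z"] by simp
  also have "A \<inter> Z - {z} = A \<inter> (Z - {z})" by blast
  finally show ?thesis using assms by linarith
qed

lemma card_minus_one_Int_minus_one: "t \<le> card ((Z - {z}) \<inter> (Z - {z'}))"
proof (rule card_Int_minus_one)
  show "t + 1 \<le> card ((Z - {z}) \<inter> Z)"
    using card_Z t_less finite_Z by (simp add: Int_absorb2 card_Diff_singleton_if)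
qed

lemma card_trace_Int_minus_one:
  assumes "A \<inter> Z = T" "z \<in> T"
  shows "card (A \<inter> (Z - {z})) < t"
proof -
  have "A \<inter> (Z - {z}) = T - {z}" using assms by blast
  then show ?thesis using assms(2) finite_T card_T t_pos by simp
qed

end

section \<open>The size of the extremal family\<close>

context parameters
begin

text \<open>The stars of \<open>insert v T\<close> with \<open>v \<in> Z - T\<close> lie in the
  family, and two of them share only sets above \<open>t + 2\<close> fixed points.\<close>

lemma lower_le_card:
  assumes "T \<subseteq> Z" "Z \<subseteq> {1..n}" "card T = t" "card Z = k + 1"
  shows "lower \<le> real (card {F \<in> nsets {1..n} k. T \<subseteq> F \<and> t + 1 \<le> card (F \<inter> Z)})"
proof -
  let ?H = "{F \<in> nsets {1..n} k. T \<subseteq> F \<and> t + 1 \<le> card (F \<inter> Z)}"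
  let ?S = "\<lambda>v. {F \<in> nsets {1..n} k. insert v T \<subseteq> F}"
  let ?c1 = "(n - (t + 1)) choose (k - (t + 1))" and ?c2 = "(n - (t + 2)) choose (k - (t + 2))"
  have fin: "finite Z" "finite T" using assms finite_subset by (meson finite_atLeastAtMost)+
  have cZ: "card (Z - T) = k - t + 1" using fin assms k_ge by (simp add: card_Diff_subset)
  have finS: "finite {F \<in> nsets {1..n} k. P F}" for P
    using finite_imp_finite_nsets[of "{1..n}" k] by simp
  have "card (Z - T) * ?c1 \<le> card (\<Union>v\<in>Z - T. ?S v) + (card (Z - T) choose 2) * ?c2"
  proof (rule mult_card_le_card_UNION)
    show "card (?S v) = ?c1" if "v \<in> Z - T" for v
    proof -
      have "card (insert v T) = t + 1" "insert v T \<subseteq> {1..n}" using that assms fin by auto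
      then show ?thesis using card_supersets_nsets[of "{1..n}" "insert v T" k] k_ge by simp
    qed
    show "card (?S v \<inter> ?S w) \<le> ?c2" if "v \<in> Z - T" "w \<in> Z - T" "v \<noteq> w" for v w
    proof -
      have "?S v \<inter> ?S w = {F \<in> nsets {1..n} k. insert v (insert w T) \<subseteq> F}" by auto
      moreover have "card (insert v (insert w T)) = t + 2" using that fin assms by auto
      moreover have "insert v (insert w T) \<subseteq> {1..n}" using that assms by auto
      ultimately show ?thesis
        using card_supersets_nsets[of "{1..n}" "insert v (insert w T)" k] k_ge by simp
    qed
  qed (use fin finS in auto)
  moreover have "card (\<Union>v\<in>Z - T. ?S v) \<le> card ?H"
  proof (rule card_mono[OF finS], rule subsetI)
    fix F assume "F \<in> (\<Union>v\<in>Z - T. ?S v)"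
    then obtain v where v: "v \<in> Z - T" "F \<in> nsets {1..n} k" "insert v T \<subseteq> F" by blast
    then have "card (insert v T) \<le> card (F \<inter> Z)" using fin assms(1) by (intro card_mono) auto
    then show "F \<in> ?H" using v assms fin by auto
  qed
  ultimately have "(k - t + 1) * ?c1 \<le> card ?H + ((k - t + 1) choose 2) * ?c2"
    unfolding cZ by linarith
  then have "real ((k - t + 1) * ?c1) \<le> real (card ?H + ((k - t + 1) choose 2) * ?c2)"
    by (simp only: of_nat_le_iff)
  then have "m * N 1 \<le> real (card ?H) + real ((k - t + 1) choose 2) * N 2"
    by (simp only: of_nat_add of_nat_mult m_def N_def)
  moreover have "real ((k - t + 1) choose 2) = m * (m - 1) / 2"
  proof -
    have "2 * ((k - t + 1) choose 2) = (k - t + 1) * (k - t)"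
      using times_binomial_minus1_eq[of 2 "k - t + 1"] by simp
    then have "real (2 * ((k - t + 1) choose 2)) = real ((k - t + 1) * (k - t))" by (rule arg_cong)
    moreover have "m * (m - 1) = real (k - t + 1) * real (k - t)"
      unfolding m_diff by (simp only: m_def)
    ultimately have "2 * real ((k - t + 1) choose 2) = m * (m - 1)"
      by (simp only: of_nat_mult of_nat_numeral)
    then show ?thesis by simp
  qed
  ultimately have "m * N 1 \<le> real (card ?H) + m * (m - 1) / 2 * N 2" by (simp only:)
  then show ?thesis unfolding lower_def by linarith
qed

text \<open>Only pairs between \<open>\<A>\<close> and \<open>\<B>\<close> meet in fewer than
  \<open>t\<close> points, and both classes have at most \<open>s\<close> members. The resulting
  size is the benchmark for a maximum family.\<close>

lemma exists_extremal:
  "\<exists>\<G>. almost_not_t_intersecting n k s t \<G> \<and>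
    card {F \<in> nsets {1..n} k. {1..t} \<subseteq> F \<and> card (F \<inter> {1..k+1}) \<ge> t + 1} + s + min t s \<le> card \<G>"
proof -
  let ?T = "{1..t}" and ?Z = "{1..k+1}"
  let ?H = "{F \<in> nsets {1..n} k. ?T \<subseteq> F \<and> card (F \<inter> ?Z) \<ge> t + 1}"
  interpret flag k t ?T ?Z
    using t_pos k_ge by unfold_locales auto
  \<comment> \<open>There are enough candidates for \<open>\<A>\<close>: adding \<open>k - t\<close>
    points of \<open>{k + 2..n}\<close> to \<open>{1..t}\<close> already gives at least
    \<open>n - (k + 1) \<ge> s\<close> sets.\<close>
  have "s \<le> card {F \<in> nsets {1..n} k. F \<inter> ?Z = ?T}"
  proof -
    let ?Y = "{k + 2..n}"
    have "bij_betw (\<lambda>G. G \<union> ?T) (nsets ?Y (k - t)) ((\<lambda>G. G \<union> ?T) ` nsets ?Y (k - t))"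
    proof (rule inj_on_imp_bij_betw, rule inj_onI)
      fix G G' assume "G \<in> nsets ?Y (k - t)" "G' \<in> nsets ?Y (k - t)" "G \<union> ?T = G' \<union> ?T"
      then have "G = (G \<union> ?T) \<inter> ?Y" "G' = (G \<union> ?T) \<inter> ?Y" using k_ge by (auto simp: nsets_def)
      then show "G = G'" by simp
    qed
    then have "card (nsets ?Y (k - t)) = card ((\<lambda>G. G \<union> ?T) ` nsets ?Y (k - t))"
      by (rule bij_betw_same_card)
    also have "\<dots> \<le> card {F \<in> nsets {1..n} k. F \<inter> ?Z = ?T}"
    proof (rule card_mono)
      show "(\<lambda>G. G \<union> ?T) ` nsets ?Y (k - t) \<subseteq> {F \<in> nsets {1..n} k. F \<inter> ?Z = ?T}"
      proof (rule image_subsetI)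
        fix G assume "G \<in> nsets ?Y (k - t)"
        then have G: "G \<subseteq> ?Y" "finite G" "card G = k - t" by (auto simp: nsets_def)
        have "card (G \<union> ?T) = card G + card ?T"
          using G k_ge by (intro card_Un_disjoint) auto
        then have "card (G \<union> ?T) = k" using G k_ge by simp
        then show "G \<union> ?T \<in> {F \<in> nsets {1..n} k. F \<inter> ?Z = ?T}"
          using G(1,2) k_ge n_gt_k_s by (fastforce simp: nsets_def)
      qed
    qed (simp add: finite_imp_finite_nsets)
    finally have "(n - (k + 1)) choose (k - t) \<le> card {F \<in> nsets {1..n} k. F \<inter> ?Z = ?T}" by simp
    moreover have "n - (k + 1) \<le> (n - (k + 1)) choose (k - t)"
    proof (rule le_binomial)
      have "1 * (m * 1 + 1) \<le> 2 * M * (m\<^sup>2 + real s)"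
        using M_ge_3 m_ge s_pos by (intro mult_mono add_mono) (auto simp: power2_eq_square)
      then have "m + 1 \<le> real n - real k" using n_minus_k_ge by simp
      then show "k - t < n - (k + 1)" unfolding m_def by linarith
    qed (use k_ge in simp)
    ultimately show ?thesis using n_gt_k_s by linarith
  qed
  then obtain \<A> where \<A>: "\<A> \<subseteq> {F \<in> nsets {1..n} k. F \<inter> ?Z = ?T}" "card \<A> = s" "finite \<A>"
    by (rule obtain_subset_with_card_n)
  \<comment> \<open>A \<open>k\<close>-subset of \<open>{1..k+1}\<close> not containing
    \<open>{1..t}\<close> omits exactly one point, and this lies in \<open>{1..t}\<close>. So there
    are \<open>t\<close> candidates for \<open>\<B>\<close>; hence the minimum with
    \<open>t\<close>.\<close>
  have "card ((\<lambda>z. ?Z - {z}) ` ?T) = t"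
  proof (subst card_image)
    show "inj_on (\<lambda>z. ?Z - {z}) ?T"
    proof (rule inj_onI)
      fix x y assume "x \<in> ?T" "y \<in> ?T" "?Z - {x} = ?Z - {y}"
      then show "x = y" using T_sub by blast
    qed
  qed simp
  then have "min t s \<le> card ((\<lambda>z. ?Z - {z}) ` ?T)" by simp
  then obtain \<B> where \<B>: "\<B> \<subseteq> (\<lambda>z. ?Z - {z}) ` ?T" "card \<B> = min t s" "finite \<B>"
    by (rule obtain_subset_with_card_n)
  define H where "H = ?H"
  have H: "finite F" "?T \<subseteq> F" "t + 1 \<le> card (F \<inter> ?Z)" if "F \<in> H" for F
    using that unfolding H_def by (auto simp: nsets_def)
  have A: "finite F" "?T \<subseteq> F" "F \<inter> ?Z = ?T" if "F \<in> \<A>" for F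
    using that \<A>(1) by (auto simp: nsets_def)
  have B: "\<exists>z\<in>?T. F = ?Z - {z}" if "F \<in> \<B>" for F using that \<B>(1) by blast
  have notT: "\<not> ?T \<subseteq> F" if "F \<in> \<B>" for F using B[OF that] by blast
  define G where "G = H \<union> \<A> \<union> \<B>"
  have HG: "{F' \<in> G. card (F' \<inter> F) < t} = {}" if F: "F \<in> H" for F
  proof -
    have "\<not> card (F' \<inter> F) < t" if F': "F' \<in> G" for F'
    proof -
      consider "F' \<in> H" | "F' \<in> \<A>" | "F' \<in> \<B>" using F' by (auto simp: G_def)
      then have "t \<le> card (F' \<inter> F)"
      proof cases
        case 1 then show ?thesis by (intro card_Int_contain H F)
      next
        case 2 then show ?thesis by (intro card_Int_contain H(2) A(1,2) F)
      next
        case 3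
        obtain z where "F' = ?Z - {z}" using B[OF 3] by blast
        then show ?thesis using card_Int_minus_one[OF H(3)[OF F], of z] by (simp add: Int_commute)
      qed
      then show ?thesis by simp
    qed
    then show ?thesis by blast
  qed
  have AG: "{F' \<in> G. card (F' \<inter> F) < t} \<subseteq> \<B>" if F: "F \<in> \<A>" for F
  proof -
    have "\<not> card (F' \<inter> F) < t" if "F' \<in> H \<union> \<A>" for F'
    proof -
      have "finite F'" "?T \<subseteq> F'" using that H(1,2)[of F'] A(1,2)[of F'] by blast+
      then show ?thesis using card_Int_contain[of F' F] A(2)[OF F] by simp
    qed
    then show ?thesis unfolding G_def by blast
  qed
  have BG: "{F' \<in> G. card (F' \<inter> F) < t} \<subseteq> \<A>" if F: "F \<in> \<B>" for F
  proof -
    obtain z where z: "F = ?Z - {z}" using B[OF F] by blast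
    have "\<not> card (F' \<inter> F) < t" if F': "F' \<in> H \<union> \<B>" for F'
    proof (cases "F' \<in> H")
      case True
      then show ?thesis using card_Int_minus_one[OF H(3)] z by (simp add: not_less)
    next
      case False
      then have "F' \<in> \<B>" using F' by blast
      then obtain z' where "F' = ?Z - {z'}" using B[of F'] by blast
      then show ?thesis using card_minus_one_Int_minus_one z by (simp add: not_less)
    qed
    then show ?thesis unfolding G_def by blast
  qed
  have "almost_t_intersecting s t G"
    unfolding almost_t_intersecting_def
  proof
    fix F assume "F \<in> G"
    then consider "F \<in> H" | "F \<in> \<A>" | "F \<in> \<B>" unfolding G_def by blast
    then show "card {F' \<in> G. card (F' \<inter> F) < t} \<le> s"
    proof cases
      case 1 show ?thesis by (simp only: HG[OF 1] card.empty le0)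
    next
      case 2 then show ?thesis using card_mono[OF \<B>(3) AG[OF 2]] \<B>(2) by linarith
    next
      case 3 then show ?thesis using card_mono[OF \<A>(3) BG[OF 3]] \<A>(2) by linarith
    qed
  qed
  moreover have "G \<subseteq> nsets {1..n} k"
  proof -
    have "F \<in> nsets {1..n} k" if F: "F \<in> \<B>" for F
    proof -
      obtain z where z: "z \<in> ?T" "F = ?Z - {z}" using B[OF F] by blast
      then have "z \<in> ?Z" using T_sub by blast
      then have "card F = k" unfolding z(2) by simp
      moreover have "F \<subseteq> {1..n}" "finite F" using z(2) n_gt_k_s by auto
      ultimately show ?thesis by (simp add: nsets_def)
    qed
    then show ?thesis using \<A>(1) unfolding G_def H_def by blast
  qed
  moreover have "\<not> t_intersecting t G"
  proof -
    have "\<A> \<noteq> {}" "\<B> \<noteq> {}" using \<A>(2) \<B>(2) s_pos t_pos by auto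
    then obtain F F' where F: "F \<in> \<A>" "F' \<in> \<B>" by blast
    obtain z where "z \<in> ?T" "F' = ?Z - {z}" using B[OF F(2)] by blast
    then have "\<not> t \<le> card (F \<inter> F')"
      using card_trace_Int_minus_one[OF A(3)[OF F(1)], of z] by (simp add: not_le)
    moreover have "F \<in> G" "F' \<in> G" using F by (auto simp: G_def)
    ultimately show ?thesis unfolding t_intersecting_def by blast
  qed
  moreover have "card G = card ?H + s + min t s"
  proof -
    have finH: "finite H" unfolding H_def using finite_imp_finite_nsets[of "{1..n}" k] by simp
    have "F \<notin> \<A>" if "F \<in> H" for F
      using H(3)[OF that] A(3)[of F] by auto
    then have "H \<inter> \<A> = {}" by blast
    then have "card (H \<union> \<A>) = card H + card \<A>" using finH \<A>(3) by (intro card_Un_disjoint)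
    moreover have "(H \<union> \<A>) \<inter> \<B> = {}" using notT H(2) A(2) by blast
    then have "card G = card (H \<union> \<A>) + card \<B>"
      unfolding G_def using finH \<A>(3) \<B>(3) by (intro card_Un_disjoint) auto
    ultimately show ?thesis using \<A>(2) \<B>(2) unfolding H_def by linarith
  qed
  ultimately show ?thesis
    unfolding almost_not_t_intersecting_def by (intro exI[of _ G]) simp
qed

end

section \<open>Upper bound and equality case\<close>

theorem theorem1p4:
  fixes n k t s :: nat and \<F> :: "nat set set"
  assumes "n > 0" and "k > 0" and "t > 0" and "s > 0"
    and "k \<ge> t + 2"
    and "real n \<ge> 3 * max (real ((t + 2) choose 2)) ((real k - real t) / 2)
                    * ((real k - real t + 1)^2 + real s)"
    and "almost_not_t_intersecting n k s t \<F>"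
    and "\<And>\<G>. almost_not_t_intersecting n k s t \<G> \<Longrightarrow> card \<G> \<le> card \<F>"
  shows "\<exists>\<A> \<B>.
    \<A> \<in> nsets {F \<in> nsets {1..n} k. F \<inter> {1..k+1} = {1..t}} s \<and>
    \<B> \<in> nsets {F \<in> nsets {1..k+1} k. \<not> {1..t} \<subseteq> F} (min t s) \<and>
    family_iso n \<F>
      ({F \<in> nsets {1..n} k. {1..t} \<subseteq> F \<and> card (F \<inter> {1..k+1}) \<ge> t + 1} \<union> \<A> \<union> \<B>)"
proof -
  interpret almost_parameters n k t s \<F>
    using assms unfolding almost_not_t_intersecting_def by unfold_locales blast+
  define H0 where "H0 = {F \<in> nsets {1..n} k. {1..t} \<subseteq> F \<and> card (F \<inter> {1..k+1}) \<ge> t + 1}"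
  have finH0: "finite H0" unfolding H0_def using finite_imp_finite_nsets[of "{1..n}" k] by simp
  \<comment> \<open>Maximality enters through this inequality, which later forces equality in the
    estimates of the three parts of \<open>\<F>\<close>.\<close>
  have max: "card H0 + s + min t s \<le> card \<F>"
    using exists_extremal assms(8) unfolding H0_def by (meson order_trans)
  have "lower \<le> real (card H0)"
    unfolding H0_def using lower_le_card[of "{1..t}" "{1..k+1}"] n_gt_k_s k_ge by simp
  then have "lower + real s \<le> real (card \<F>)" using max by linarith
  then obtain T Z where TZ: "T \<subseteq> Z" "Z \<subseteq> {1..n}" "card T = t" "card Z = k + 1"
    and center: "\<And>A. A \<in> \<F> \<Longrightarrow> T \<subseteq> A \<or> A \<subseteq> Z"
    using obtain_center by blast
  interpret flag k t T Z
    using TZ t_pos k_ge finite_subset[OF TZ(2)] by unfold_locales auto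
  define H where "H = {A \<in> \<F>. T \<subseteq> A \<and> t + 1 \<le> card (A \<inter> Z)}"
  define \<A> where "\<A> = {A \<in> \<F>. A \<inter> Z = T}"
  define \<B> where "\<B> = {A \<in> \<F>. \<not> T \<subseteq> A}"
  have fin: "finite H" "finite \<A>" "finite \<B>" using finite_family by (auto simp: H_def \<A>_def \<B>_def)
  have split: "\<F> = H \<union> \<A> \<union> \<B>"
  proof
    show "\<F> \<subseteq> H \<union> \<A> \<union> \<B>"
    proof
      fix F assume F: "F \<in> \<F>"
      have "F \<inter> Z = T" if "T \<subseteq> F" "\<not> t + 1 \<le> card (F \<inter> Z)"
        using card_seteq[of "F \<inter> Z" T] that finite_Z T_sub card_T by auto
      then show "F \<in> H \<union> \<A> \<union> \<B>" using F by (auto simp: H_def \<A>_def \<B>_def)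
    qed
  qed (auto simp: H_def \<A>_def \<B>_def)
  have B: "\<exists>z\<in>T. F = Z - {z}" if "F \<in> \<B>" for F
  proof -
    have F: "F \<in> \<F>" "\<not> T \<subseteq> F" using that by (auto simp: \<B>_def)
    then have "F \<subseteq> Z" using center by blast
    then show ?thesis
      using nsets_minus_one[OF finite_Z card_Z _ memD(2)[OF F(1)] F(2) T_sub] by blast
  qed
  have AB: "card (F' \<inter> F) < t" if AB: "F \<in> \<A>" "F' \<in> \<B>" for F F'
  proof -
    obtain z where "z \<in> T" "F' = Z - {z}" using B[OF AB(2)] by blast
    then show ?thesis
      using card_trace_Int_minus_one[of F z] AB(1) by (simp add: \<A>_def Int_commute)
  qed
  have "card \<B> \<le> t"
  proof -
    have "\<B> \<subseteq> (\<lambda>z. Z - {z}) ` T" using B by blast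
    then have "card \<B> \<le> card T" by (rule surj_card_le[OF finite_T])
    then show ?thesis by (simp add: card_T)
  qed
  have intersecting: "t \<le> card (F \<inter> F')"
    if FF: "F \<in> \<F>" "F' \<in> \<F>" "F \<notin> \<A> \<or> F' \<notin> \<B>" "F \<notin> \<B> \<or> F' \<notin> \<A>" for F F'
  proof -
    have "T \<subseteq> X" if "X \<in> H \<union> \<A>" for X using that unfolding H_def \<A>_def by blast
    moreover have "F \<in> H \<union> \<A> \<union> \<B>" "F' \<in> H \<union> \<A> \<union> \<B>" using FF(1,2) by (simp_all only: split[symmetric])
    ultimately consider "T \<subseteq> F" "T \<subseteq> F'" | "F \<in> \<B>" "F' \<in> \<B>" | "F \<in> H" "F' \<in> \<B>" | "F \<in> \<B>" "F' \<in> H"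
      using FF(3,4) by blast
    then show ?thesis
    proof cases
      case 1
      then show ?thesis by (intro card_Int_contain memD(1)[OF FF(1)])
    next
      case 2
      then show ?thesis using B[OF 2(1)] B[OF 2(2)] card_minus_one_Int_minus_one by auto
    next
      case 3
      then show ?thesis using B[OF 3(2)] card_Int_minus_one[of F] by (auto simp: H_def)
    next
      case 4
      then show ?thesis using B[OF 4(1)] card_Int_minus_one[of F'] by (auto simp: H_def Int_commute)
    qed
  qed
  \<comment> \<open>Only pairs between \<open>\<A>\<close> and \<open>\<B>\<close> can fail to meet
    in \<open>t\<close> points, and such a pair exists. So each class has a member, and that member
    bounds the other class by \<open>s\<close>.\<close>
  have ne: "\<A> \<noteq> {}" "\<B> \<noteq> {}"
    using intersecting not_intersecting unfolding t_intersecting_def by (metis empty_iff)+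
  have "card \<A> \<le> s"
  proof -
    obtain F' where F': "F' \<in> \<B>" using ne by blast
    have "\<A> \<subseteq> {F \<in> \<F>. card (F \<inter> F') < t}"
      using AB[OF _ F'] by (auto simp: \<A>_def Int_commute)
    then have "card \<A> \<le> card {F \<in> \<F>. card (F \<inter> F') < t}"
      using finite_family by (intro card_mono) auto
    then show ?thesis using card_disturbing_le[of F'] F' by (simp add: \<B>_def)
  qed
  have "card \<B> \<le> s"
  proof -
    obtain F where F: "F \<in> \<A>" using ne by blast
    have "\<B> \<subseteq> {F' \<in> \<F>. card (F' \<inter> F) < t}"
      using AB[OF F] by (auto simp: \<B>_def)
    then have "card \<B> \<le> card {F' \<in> \<F>. card (F' \<inter> F) < t}"
      using finite_family by (intro card_mono) auto
    then show ?thesis using card_disturbing_le[of F] F by (simp add: \<A>_def)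
  qed
  obtain \<pi> where \<pi>: "\<pi> permutes {1..n}" "\<pi> ` T = {1..t}" "\<pi> ` Z = {1..k+1}"
    using obtain_flag_permutation[OF TZ] by blast
  have inj: "inj \<pi>" using \<pi>(1) by (rule permutes_inj)
  let ?p = "\<lambda>F. \<pi> ` F"
  have inj_p: "inj_on ?p X" for X using inj by (meson inj_image_eq_iff inj_onI)
  have image: "?p F \<in> nsets {1..n} k" if "F \<in> \<F>" for F
  proof -
    have "?p F \<subseteq> ?p {1..n}" by (rule image_mono[OF memD(3)[OF that]])
    then have "?p F \<subseteq> {1..n}" by (simp only: permutes_image[OF \<pi>(1)])
    moreover have "card (?p F) = k" using card_image[OF inj_on_subset[OF inj]] memD(2)[OF that] by simp
    ultimately show ?thesis using memD(1)[OF that] by (simp add: nsets_def)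
  qed
  have trace: "?p F \<inter> {1..k+1} = ?p (F \<inter> Z)" for F
    using image_Int[OF inj, of F Z] \<pi>(3) by simp
  have sub: "{1..t} \<subseteq> ?p F \<longleftrightarrow> T \<subseteq> F" for F
    using inj_image_subset_iff[OF inj, of T F] \<pi>(2) by simp
  have "?p ` H \<subseteq> H0"
  proof
    fix X assume "X \<in> ?p ` H"
    then obtain F where F: "F \<in> \<F>" "T \<subseteq> F" "t + 1 \<le> card (F \<inter> Z)" "X = ?p F" by (auto simp: H_def)
    have "card (X \<inter> {1..k+1}) = card (F \<inter> Z)"
      unfolding F(4) trace by (rule card_image[OF inj_on_subset[OF inj]]) simp
    then show "X \<in> H0" using F image sub unfolding H0_def by simp
  qed
  then have "card H \<le> card H0" using card_mono[OF finH0, of "?p ` H"] card_image[OF inj_p, of H] by simp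
  moreover have "card \<F> \<le> card H + card \<A> + card \<B>"
    unfolding split by (intro order.trans[OF card_Un_le] add_mono order.refl)
  \<comment> \<open>The upper bounds \<open>card H0\<close>, \<open>s\<close> and
    \<open>min t s\<close> add up to the lower bound in \<open>max\<close>, so each is
    attained.\<close>
  ultimately have cards: "card H = card H0" "card \<A> = s" "card \<B> = min t s"
    using max \<open>card \<A> \<le> s\<close> \<open>card \<B> \<le> s\<close> \<open>card \<B> \<le> t\<close> by linarith+
  have "?p ` H = H0"
    using card_subset_eq[OF finH0 \<open>?p ` H \<subseteq> H0\<close>] cards(1) card_image[OF inj_p, of H] by simp
  then have iso: "?p ` \<F> = H0 \<union> ?p ` \<A> \<union> ?p ` \<B>"
    by (subst split) (simp only: image_Un)
  have "?p ` \<A> \<subseteq> {F \<in> nsets {1..n} k. F \<inter> {1..k+1} = {1..t}}"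
  proof (rule image_subsetI)
    fix F assume "F \<in> \<A>"
    then have F: "F \<in> \<F>" "F \<inter> Z = T" by (auto simp: \<A>_def)
    have "?p F \<inter> {1..k+1} = {1..t}" unfolding trace F(2) by (rule \<pi>(2))
    then show "?p F \<in> {F \<in> nsets {1..n} k. F \<inter> {1..k+1} = {1..t}}" using image[OF F(1)] by blast
  qed
  then have "?p ` \<A> \<in> nsets {F \<in> nsets {1..n} k. F \<inter> {1..k+1} = {1..t}} s"
    using fin(2) cards(2) card_image[OF inj_p, of \<A>] by (simp add: nsets_def[of _ s])
  moreover have "?p ` \<B> \<subseteq> {F \<in> nsets {1..k+1} k. \<not> {1..t} \<subseteq> F}"
  proof
    fix X assume "X \<in> ?p ` \<B>"
    then obtain F where F: "F \<in> \<F>" "\<not> T \<subseteq> F" "X = ?p F" by (auto simp: \<B>_def)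
    then have "X \<subseteq> {1..k+1}" using center[OF F(1)] image_mono[of F Z \<pi>] \<pi>(3) by auto
    then show "X \<in> {F \<in> nsets {1..k+1} k. \<not> {1..t} \<subseteq> F}"
      using image[OF F(1)] F sub by (simp add: nsets_def)
  qed
  then have "?p ` \<B> \<in> nsets {F \<in> nsets {1..k+1} k. \<not> {1..t} \<subseteq> F} (min t s)"
    using fin(3) cards(3) card_image[OF inj_p, of \<B>] by (simp add: nsets_def[of _ "min t s"])
  moreover have "family_iso n \<F> (H0 \<union> ?p ` \<A> \<union> ?p ` \<B>)"
    unfolding family_iso_def using \<pi>(1) iso by blast
  ultimately show ?thesis unfolding H0_def by blast
qed

end
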